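(* Let $M$ be an $n$-dimensional submanifold of the Euclidean space $\mathbb{R}^m$, $m=n+k$, let $x\in M$, and let $r\ge 1$ be an integer. Let $Y_1,\ldots,Y_n$ be an arbitrary orthonormal frame of tangent vector fields of $M$ in a neighborhood of $x$. For $l\ge 1$ let $P^{(l)}$, $k_l=\operatorname{rank}P^{(l)}$ and $N^{(l)}_1,\ldots,N^{(l)}_{k_l}$ be the matrices, their ranks, and the $l$-th normal vectors of $M$ defined in the context. Then, at the point $x$: (i) $k_r=\operatorname{rank}P^{(r)}\le \binom{n+r}{r+1}$. (ii) The vector space generated by the eigenvectors of $P^{(r)}$ belonging to positive eigenvalues (regarded as vectors of $\mathbb{R}^m$, i.e. the span of $N^{(r)}_1,\ldots,N^{(r)}_{k_r}$) coincides with the vector space generated by the orthogonal projections of the vectors $$\nabla_{Y_{i_1}}\nabla_{Y_{i_2}}\cdots\nabla_{Y_{i_r}}Y_{i_{r+1}},\qquad 1\le i_1\le i_2\le\cdots\le i_{r+1}\le n,$$ onto the orthogonal complement in $\mathbb{R}^m$ of the space generated by $$Y_1,\ldots,Y_n,\;N^{(1)}_1,\ldots,N^{(1)}_{k_1},\;\ldots,\;N^{(r-1)}_1,\ldots,N^{(r-1)}_{k_{r-1}}$$ (for $r=1$, the space generated by $Y_1,\ldots,Y_n$). (iii) The $r$-th osculating space, i.e. the space generated by $$Y_1,\ldots,Y_n,\;N^{(1)}_1,\ldots,N^{(1)}_{k_1},\;\ldots,\;N^{(r)}_1,\ldots,N^{(r)}_{k_r},$$ coincides with the space generated by $Y_1,\ldots,Y_n$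 together with all the vectors $$\nabla_{Y_{i_1}}\nabla_{Y_{i_2}}\cdots\nabla_{Y_{i_s}}Y_{i_{s+1}},\qquad 1\le s\le r,\quad 1\le i_1\le i_2\le\cdots\le i_{s+1}\le n.$$
   Context: Everything is smooth. $\nabla$ denotes the flat connection of $\mathbb{R}^m$: for a tangent vector field $Y$ of $M$ and an $\mathbb{R}^m$-valued function $V$ on (an open subset of) $M$, $\nabla_Y V$ is the directional derivative of $V$ along $Y$. The dot is the Euclidean inner product of $\mathbb{R}^m$. Normal vectors are defined inductively. Put $k_0=n$ and $N^{(0)}_i=Y_i$ for $1\le i\le n$, where $Y_1,\ldots,Y_n$ is a local orthonormal frame of the tangent spaces of $M$. Suppose that for some $l\ge 0$ the vectors $N^{(s)}_i$ ($0\le s\le l$, $1\le i\le k_s$) have been defined at the points of a neighborhood of $x$ in $M$; they are orthonormal at each point. Let $O_l$ be their span at each point ($O_0$ is the tangent space). Choose smooth orthonormal vector fields $N_\alpha$, $k_1+\cdots+k_l+1\le\alpha\le k$, along $M$ near $x$ which form at each point a basis of the orthogonal complement of $O_l$ in $\mathbb{R}^m$. Define the symmetric positive semidefinite $(k-k_1-\cdots-k_l)\times(k-k_1-\cdots-k_l)$ matrix $$P^{(l+1)}_{\alpha\beta}=\sum_{i=1}^{k_l}\sum_{j=1}^{n}\bigl(N^{(l)}_i\cdot\nabla_{Y_j}N_\alpha\bigr)\bigl(N^{(l)}_i\cdot\nabla_{Y_j}N_\beta\bigr).$$ In particular $P^{(1)}_{\alpha\beta}=\sum_{i,j=1}^{n}(Y_i\cdot\nabla_{Y_j}N_\alpha)(Y_i\cdot\nabla_{Y_j}N_\beta)$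 for $1\le\alpha,\beta\le k$. Put $k_{l+1}=\operatorname{rank}P^{(l+1)}$. An eigenvector $(p_\alpha)$ of $P^{(l+1)}$ is identified with the vector $\sum_\alpha p_\alpha N_\alpha\in\mathbb{R}^m$. The $(l+1)$-st normal vectors $N^{(l+1)}_1,\ldots,N^{(l+1)}_{k_{l+1}}$ at a point are the vectors of $\mathbb{R}^m$ so obtained from an orthonormal system of eigenvectors of $P^{(l+1)}$ belonging to its $k_{l+1}$ positive eigenvalues (counted with multiplicity). Under this identification the eigenspaces do not depend on the choice of the fields $N_\alpha$, nor on the choice of orthonormal bases. Standing assumption needed for the inductive definition: the ranks $k_1,k_2,\ldots$ are constant on a neighborhood of $x$, so that the spaces $O_l$ form smooth vector bundles near $x$ and the smooth fields $N_\alpha$ exist. If $k_1+\cdots+k_l=k$, the matrix $P^{(l+1)}$ is empty and $k_{l+1}=0$; if $k_l=0$, then $P^{(l+1)}=0$. *)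

theory Defs
  imports "Jordan_Normal_Form.Char_Poly" "Jordan_Normal_Form.DL_Rank" "HOL-Analysis.Analysis"
begin

section \<open>Smoothness\<close>

text \<open>\<open>Ck_on k S f\<close> is meant for open \<open>S\<close> and finite-dimensional domains, where it is the usual
  notion of a \<open>k\<close> times continuously differentiable function.\<close>

fun Ck_on :: "nat \<Rightarrow> 'a::real_normed_vector set \<Rightarrow> ('a \<Rightarrow> 'b::real_normed_vector) \<Rightarrow> bool" where
  "Ck_on 0 S f \<longleftrightarrow> continuous_on S f"
| "Ck_on (Suc k) S f \<longleftrightarrow>
     (\<forall>x\<in>S. f differentiable (at x)) \<and> (\<forall>v. Ck_on k S (\<lambda>x. frechet_derivative f (at x) v))"

text \<open>For arbitrary \<open>A\<close>, smoothness means the existence of smooth local extensions; for open \<open>A\<close>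
  one may take \<open>f\<close> itself as the extension.\<close>

definition smooth_on :: "'a::real_normed_vector set \<Rightarrow> ('a \<Rightarrow> 'b::real_normed_vector) \<Rightarrow> bool" where
  "smooth_on A f \<longleftrightarrow>
     (\<forall>p\<in>A. \<exists>W g. open W \<and> p \<in> W \<and> (\<forall>k. Ck_on k W g) \<and> (\<forall>q\<in>A \<inter> W. g q = f q))"

section \<open>Submanifolds of Euclidean space\<close>

definition submanifold :: "nat \<Rightarrow> 'a::euclidean_space set \<Rightarrow> bool" where
  "submanifold n M \<longleftrightarrow>
     (\<forall>p\<in>M. \<exists>U V \<phi> \<psi> (E :: 'a set).
        open U \<and> p \<in> U \<and> open V \<and> homeomorphism U V \<phi> \<psi> \<and> smooth_on U \<phi> \<and> smooth_on V \<psi> \<and>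
        Real_Vector_Spaces.subspace E \<and> dim E = n \<and> \<phi> ` (M \<inter> U) = E \<inter> V)"

definition tangent_space :: "'a::euclidean_space set \<Rightarrow> 'a \<Rightarrow> 'a set" where
  "tangent_space M p =
     {v. \<exists>\<gamma> e. 0 < e \<and> smooth_on {-e<..<e::real} \<gamma> \<and> \<gamma> ` {-e<..<e} \<subseteq> M \<and> \<gamma> 0 = p \<and>
           (\<gamma> has_vector_derivative v) (at 0)}"

definition orthonormal_tangent_frame ::
    "nat \<Rightarrow> 'a::euclidean_space set \<Rightarrow> 'a set \<Rightarrow> (nat \<Rightarrow> 'a \<Rightarrow> 'a) \<Rightarrow> bool" where
  "orthonormal_tangent_frame n M U Y \<longleftrightarrow>
     (\<forall>i\<in>{1..n}. smooth_on (M \<inter> U) (Y i)) \<and>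
     (\<forall>p\<in>M \<inter> U.
        (\<forall>i\<in>{1..n}. Y i p \<in> tangent_space M p) \<and>
        (\<forall>i\<in>{1..n}. \<forall>j\<in>{1..n}. inner (Y i p) (Y j p) = (if i = j then 1 else 0)))"

text \<open>The derivative within \<open>M\<close> is determined only on tangent vectors of \<open>M\<close>. The definition below is
  therefore meaningful when \<open>Y p\<close> is tangent to \<open>M\<close> at \<open>p\<close>; its value is then the directional
  derivative, computed along any curve in \<open>M\<close> or from any smooth extension of \<open>V\<close>. It depends only
  on the germ of \<open>V\<close> on \<open>M\<close> at \<open>p\<close>.\<close>

definition nabla :: "'a::euclidean_space set \<Rightarrow> ('a \<Rightarrow> 'a) \<Rightarrow> ('a \<Rightarrow> 'a) \<Rightarrow> 'a \<Rightarrow> 'a" where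
  "nabla M Y V = (\<lambda>p. frechet_derivative V (at p within M) (Y p))"

text \<open>For \<open>js = [i\<^sub>1, \<dots>, i\<^sub>s, j]\<close> this is \<open>\<nabla>\<close> along \<open>Y i\<^sub>1\<close> of \<open>\<nabla>\<close> along \<open>Y i\<^sub>2\<close> of \<open>\<dots>\<close> of \<open>\<nabla>\<close> along \<open>Y i\<^sub>s\<close>
  of \<open>Y j\<close>.\<close>

definition iterated_nabla ::
    "'a::euclidean_space set \<Rightarrow> (nat \<Rightarrow> 'a \<Rightarrow> 'a) \<Rightarrow> nat list \<Rightarrow> 'a \<Rightarrow> 'a" where
  "iterated_nabla M Y js = foldr (\<lambda>i V. nabla M (Y i) V) (butlast js) (Y (last js))"

definition nondecreasing_indices :: "nat \<Rightarrow> nat \<Rightarrow> nat list set" where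
  "nondecreasing_indices n s = {js. length js = s + 1 \<and> sorted js \<and> set js \<subseteq> {1..n}}"

definition orth_proj :: "'a::euclidean_space set \<Rightarrow> 'a \<Rightarrow> 'a" where
  "orth_proj W v = (THE w. w \<in> W \<and> v - w \<in> orthogonal_comp W)"

section \<open>Normal vectors\<close>

text \<open>Throughout, \<open>N s i p\<close> is the \<open>i\<close>-th of the \<open>s\<close>-th normal vectors at \<open>p\<close> (\<open>1 \<le> i \<le> \<kappa> s\<close>), and
  \<open>\<nu> l \<alpha>\<close>, for \<open>\<kappa> 1 + \<dots> + \<kappa> l < \<alpha> \<le> k\<close>, are the auxiliary fields spanning the orthogonal complement
  of \<open>osculating_space \<kappa> N l\<close>; they may be chosen anew for every \<open>l\<close>.\<close>

definition osculating_space ::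
    "(nat \<Rightarrow> nat) \<Rightarrow> (nat \<Rightarrow> nat \<Rightarrow> 'a::euclidean_space \<Rightarrow> 'a) \<Rightarrow> nat \<Rightarrow> 'a \<Rightarrow> 'a set" where
  "osculating_space \<kappa> N l p = span {N s i p | s i. s \<le> l \<and> i \<in> {1..\<kappa> s}}"

definition offset :: "(nat \<Rightarrow> nat) \<Rightarrow> nat \<Rightarrow> nat" where
  "offset \<kappa> l = (\<Sum>s = 1..l. \<kappa> s)"

definition complement_frame ::
    "'a::euclidean_space set \<Rightarrow> 'a set \<Rightarrow> nat \<Rightarrow> (nat \<Rightarrow> nat) \<Rightarrow> (nat \<Rightarrow> nat \<Rightarrow> 'a \<Rightarrow> 'a) \<Rightarrow>
     nat \<Rightarrow> (nat \<Rightarrow> 'a \<Rightarrow> 'a) \<Rightarrow> bool" where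
  "complement_frame M U k \<kappa> N l F \<longleftrightarrow>
     (let I = {offset \<kappa> l + 1..k} in
       (\<forall>\<alpha>\<in>I. smooth_on (M \<inter> U) (F \<alpha>)) \<and>
       (\<forall>p\<in>M \<inter> U.
          (\<forall>\<alpha>\<in>I. \<forall>\<beta>\<in>I. inner (F \<alpha> p) (F \<beta> p) = (if \<alpha> = \<beta> then 1 else 0)) \<and>
          span ((\<lambda>\<alpha>. F \<alpha> p) ` I) = orthogonal_comp (osculating_space \<kappa> N l p)))"

text \<open>The matrix \<open>P\<close> of level \<open>l + 1\<close> at \<open>p\<close>. The rows and columns of a \<open>mat\<close> are numbered from \<open>0\<close>:
  row \<open>a\<close> belongs to the index \<open>\<alpha> = offset \<kappa> l + 1 + a\<close>.\<close>

definition normal_matrix ::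
    "'a::euclidean_space set \<Rightarrow> nat \<Rightarrow> nat \<Rightarrow> (nat \<Rightarrow> 'a \<Rightarrow> 'a) \<Rightarrow> (nat \<Rightarrow> nat) \<Rightarrow>
     (nat \<Rightarrow> nat \<Rightarrow> 'a \<Rightarrow> 'a) \<Rightarrow> (nat \<Rightarrow> nat \<Rightarrow> 'a \<Rightarrow> 'a) \<Rightarrow> nat \<Rightarrow> 'a \<Rightarrow> real mat" where
  "normal_matrix M n k Y \<kappa> N \<nu> l p =
     Matrix.mat (k - offset \<kappa> l) (k - offset \<kappa> l) (\<lambda>(a, b).
       \<Sum>i = 1..\<kappa> l. \<Sum>j = 1..n.
         inner (N l i p) (nabla M (Y j) (\<nu> l (offset \<kappa> l + 1 + a)) p) *
         inner (N l i p) (nabla M (Y j) (\<nu> l (offset \<kappa> l + 1 + b)) p))"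

definition mat_rank :: "real mat \<Rightarrow> nat" where
  "mat_rank A = vec_space.rank (dim_row A) A"

definition vector_of_coords ::
    "nat \<Rightarrow> (nat \<Rightarrow> nat) \<Rightarrow> nat \<Rightarrow> (nat \<Rightarrow> 'a \<Rightarrow> 'a::euclidean_space) \<Rightarrow> real Matrix.vec \<Rightarrow> 'a \<Rightarrow> 'a" where
  "vector_of_coords k \<kappa> l F q p =
     (\<Sum>a<k - offset \<kappa> l. vec_index q a *\<^sub>R F (offset \<kappa> l + 1 + a) p)"

text \<open>The index range of \<open>q\<close> has \<open>mat_rank A\<close> elements at every use below, so that the \<open>q i\<close> account
  for all positive eigenvalues of the positive semidefinite matrix \<open>A\<close>, with multiplicity.\<close>

definition orthonormal_positive_eigenvectors ::
    "real mat \<Rightarrow> nat \<Rightarrow> (nat \<Rightarrow> real Matrix.vec) \<Rightarrow> bool" where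
  "orthonormal_positive_eigenvectors A K q \<longleftrightarrow>
     (\<forall>i\<in>{1..K}. \<exists>e>0. eigenvector A (q i) e) \<and>
     (\<forall>i\<in>{1..K}. \<forall>j\<in>{1..K}. scalar_prod (q i) (q j) = (if i = j then 1 else 0))"

text \<open>The inductive construction carried out up to level \<open>r\<close> on the neighbourhood \<open>M \<inter> U\<close>. As the
  \<open>\<kappa> l\<close> do not depend on \<open>p\<close>, it includes the constancy of the ranks. No regularity is required of
  the dependence of the vectors \<open>N l i p\<close>, \<open>l \<ge> 1\<close>, on \<open>p\<close>.\<close>

definition normal_vectors ::
    "'a::euclidean_space set \<Rightarrow> 'a set \<Rightarrow> nat \<Rightarrow> nat \<Rightarrow> nat \<Rightarrow> (nat \<Rightarrow> 'a \<Rightarrow> 'a) \<Rightarrow> (nat \<Rightarrow> nat) \<Rightarrow>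
     (nat \<Rightarrow> nat \<Rightarrow> 'a \<Rightarrow> 'a) \<Rightarrow> (nat \<Rightarrow> nat \<Rightarrow> 'a \<Rightarrow> 'a) \<Rightarrow> bool" where
  "normal_vectors M U n k r Y \<kappa> N \<nu> \<longleftrightarrow>
     \<kappa> 0 = n \<and> (\<forall>i\<in>{1..n}. \<forall>p\<in>M \<inter> U. N 0 i p = Y i p) \<and>
     (\<forall>l<r.
        complement_frame M U k \<kappa> N l (\<nu> l) \<and>
        (\<forall>p\<in>M \<inter> U.
           \<kappa> (l + 1) = mat_rank (normal_matrix M n k Y \<kappa> N \<nu> l p) \<and>
           (\<exists>q. orthonormal_positive_eigenvectors (normal_matrix M n k Y \<kappa> N \<nu> l p) (\<kappa> (l + 1)) q \<and>
                (\<forall>i\<in>{1..\<kappa> (l + 1)}. N (l + 1) i p = vector_of_coords k \<kappa> l (\<nu> l) (q i) p))))"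

end

theory Submission
  imports Defs
begin

text \<open>The osculating space \<open>O l\<close> is the span of all normal vectors of order at most \<open>l\<close>. The proof
  identifies it with the span of the frame and all its iterated derivatives of order at most \<open>l\<close>, by
  comparing orthogonal complements.

  Let \<open>w = \<Sum>\<alpha>. p \<alpha> \<nu> \<alpha>\<close> be orthogonal to \<open>O l\<close> at a point. By definition, \<open>w\<close> is orthogonal to the next
  normal vectors if and only if \<open>(p \<alpha>)\<close> is orthogonal to the eigenvectors of \<open>P\<close> with positive eigenvalues;
  as there are \<open>rank P\<close> of them, this means \<open>P p = 0\<close>
  (\<open>orthogonal_to_positive_eigenvectors_iff_in_kernel\<close>). \<open>P\<close> is a Gram matrix, so
  this says that every \<open>l\<close>-th normal vector is orthogonal to all \<open>\<Sum>\<alpha>. p \<alpha> \<nabla>\<^bsub>Y j\<^esub> \<nu> \<alpha>\<close>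
  (\<open>perp_normal_vectors_iff\<close>). On the other hand, if \<open>V\<close> is a smooth field with values in \<open>O l\<close>,
  differentiating \<open>V \<bullet> \<nu> \<alpha> = 0\<close> gives \<open>\<nabla>\<^bsub>Y j\<^esub> V \<bullet> w = - V \<bullet> (\<Sum>\<alpha>. p \<alpha> \<nabla>\<^bsub>Y j\<^esub> \<nu> \<alpha>)\<close>
  (\<open>inner_nabla_section\<close>). If the iterated derivatives of order at most \<open>l\<close> span \<open>O l\<close> at every point,
  they may be taken for \<open>V\<close>, and \<open>w\<close> is orthogonal to \<open>O (l + 1)\<close> if and only if it is
  orthogonal to their derivatives as well. This is the induction step of
  \<open>osculating_space_eq_derivative_span\<close>. The fields that are differentiated are the
  iterated derivatives and the \<open>\<nu> \<alpha>\<close> only, never the normal vectors of order \<open>l \<ge> 1\<close>.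

  The same identity shows that a derivative of any smooth field with values in \<open>O l\<close> lies in
  \<open>O (l + 1)\<close> (\<open>nabla_in_osculating_space_Suc\<close>). Therefore the order of differentiation is irrelevant
  modulo lower order: the commutator of \<open>\<nabla>\<^bsub>Y i\<^esub>\<close> and \<open>\<nabla>\<^bsub>Y j\<^esub>\<close> is the derivative along the bracket
  \<open>\<nabla>\<^bsub>Y i\<^esub> Y j - \<nabla>\<^bsub>Y j\<^esub> Y i\<close>, which is tangent and hence a combination of the \<open>Y k\<close>
  (\<open>bracket_in_span_frame\<close>), and the error stays of lower order under further differentiation
  (\<open>iterated_nabla_swap\<close>). Sorting the indices leaves one generator of
  the osculating space for every nondecreasing list. Projecting \<open>O r\<close> to the complement of \<open>O (r - 1)\<close>
  leaves the lists of length \<open>r + 1\<close>, whose number bounds the rank.\<close>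

no_notation Matrix.scalar_prod (infix \<open>\<bullet>\<close> 70)

section \<open>Eigenvectors and the kernel of a symmetric matrix\<close>

lemma (in vec_space) card_le_rank_if_lin_indpt_in_col_space:
  assumes A: "A \<in> carrier_mat n nc" and S: "S \<subseteq> col_space A" and li: "lin_indpt S"
  shows "card S \<le> rank A"
proof -
  let ?C = "set (cols A)"
  have C: "?C \<subseteq> carrier_vec n" using A cols_dim[of A] by auto
  have sub: "submodule class_ring (span ?C) V" using span_is_submodule[OF C] .
  have SC: "S \<subseteq> span ?C" using S by (simp add: col_space_def)
  have vs: "vectorspace class_ring (span_vs ?C)"
    using C by (simp add: span_is_subspace subspace_is_vs)
  have fd: "vectorspace.fin_dim class_ring (span_vs ?C)"
    using fin_dim_span_cols[OF A] .
  have li': "\<not> LinearCombinations.module.lin_dep class_ring (span_vs ?C) S"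
    using span_li_not_depend(2)[OF SC sub] li by simp
  show ?thesis
    unfolding rank_def
    using vectorspace.li_le_dim(2)[OF vs fd _ li'] SC by simp
qed

lemma (in vec_space) lin_indpt_if_orthogonal:
  fixes q :: "'b \<Rightarrow> 'a Matrix.vec"
  assumes I: "finite I" and q: "\<And>i. i \<in> I \<Longrightarrow> q i \<in> carrier_vec n"
    and orth: "\<And>i j. i \<in> I \<Longrightarrow> j \<in> I \<Longrightarrow> i \<noteq> j \<Longrightarrow> scalar_prod (q i) (q j) = 0"
    and nz: "\<And>i. i \<in> I \<Longrightarrow> scalar_prod (q i) (q i) \<noteq> 0"
  shows "inj_on q I" and "lin_indpt (q ` I)"
proof -
  show inj: "inj_on q I"
    using orth nz by (metis inj_onI)
  show "lin_indpt (q ` I)"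
  proof (rule finite_lin_indpt2)
    show "finite (q ` I)" and car: "q ` I \<subseteq> carrier_vec n" using I q by auto
    fix a assume z: "lincomb a (q ` I) = 0\<^sub>v n"
    show "\<forall>v\<in>q ` I. a v = 0"
    proof
      fix v assume "v \<in> q ` I"
      then obtain j where j: "j \<in> I" "v = q j" by auto
      have car': "q ` I \<subseteq> carrier_vec n" using q by auto
      have "0 = scalar_prod (lincomb a (q ` I)) (q j)" using z q[OF j(1)] by (simp add: module_vec_simps)
      also have "\<dots> = (\<Sum>t<n. lincomb a (q ` I) $ t * q j $ t)"
        using q[OF j(1)] by (simp add: scalar_prod_def atLeast0LessThan)
      also have "\<dots> = (\<Sum>t<n. (\<Sum>i\<in>I. a (q i) * q i $ t) * q j $ t)"
        by (rule sum.cong) (simp_all add: lincomb_index[OF _ car'] sum.reindex[OF inj])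
      also have "\<dots> = (\<Sum>i\<in>I. a (q i) * (scalar_prod (q i) (q j)))"
        using q[OF j(1)]
        by (simp add: scalar_prod_def atLeast0LessThan sum_distrib_left sum_distrib_right mult.assoc)
          (rule sum.swap)
      also have "\<dots> = (\<Sum>i\<in>I. if i = j then a (q j) * (scalar_prod (q j) (q j)) else 0)"
        using orth j by (intro sum.cong) auto
      also have "\<dots> = a (q j) * (scalar_prod (q j) (q j))" using I j by simp
      finally show "a v = 0" using nz[OF j(1)] j by simp
    qed
  qed
qed

text \<open>The vector \<open>A c\<close> lies in the column space and, by symmetry of \<open>A\<close>, is orthogonal to every \<open>q i\<close> if
  \<open>c\<close> is. As the \<open>q i\<close> lie in the column space and are as many as its dimension, \<open>A c \<noteq> 0\<close> would
  give one independent vector too many.\<close>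

lemma orthogonal_to_positive_eigenvectors_iff_in_kernel:
  fixes A :: "real mat"
  assumes A: "A \<in> carrier_mat m m" and sym: "transpose_mat A = A"
    and q: "orthonormal_positive_eigenvectors A (mat_rank A) q"
    and c: "c \<in> carrier_vec m"
  shows "(\<forall>i\<in>{1..mat_rank A}. scalar_prod c (q i) = 0) \<longleftrightarrow> A *\<^sub>v c = 0\<^sub>v m"
proof -
  let ?K = "mat_rank A"
  interpret vec_space "TYPE(real)" m .
  have K: "?K = rank A" using A by (simp add: mat_rank_def)
  have adj: "scalar_prod (A *\<^sub>v u) v = scalar_prod u (A *\<^sub>v v)"
    if "u \<in> carrier_vec m" "v \<in> carrier_vec m" for u v
    using transpose_vec_mult_scalar[of A m m v u] that A sym by (metis comm_scalar_prod mult_mat_vec_carrier)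
  obtain e where e: "\<And>i. i \<in> {1..?K} \<Longrightarrow> e i > 0 \<and> eigenvector A (q i) (e i)"
    using q unfolding orthonormal_positive_eigenvectors_def by metis
  have qc: "q i \<in> carrier_vec m" and Aq: "A *\<^sub>v q i = e i \<cdot>\<^sub>v q i" if "i \<in> {1..?K}" for i
    using e[OF that] A by (auto simp: eigenvector_def)
  have on: "scalar_prod (q i) (q j) = (if i = j then 1 else 0)" if "i \<in> {1..?K}" "j \<in> {1..?K}" for i j
    using q that unfolding orthonormal_positive_eigenvectors_def by blast
  have cq: "scalar_prod (A *\<^sub>v c) (q i) = e i * scalar_prod c (q i)" if i: "i \<in> {1..?K}" for i
    using adj[OF c qc[OF i]] Aq[OF i] qc[OF i] c by simp
  show ?thesis
  proof
    assume "A *\<^sub>v c = 0\<^sub>v m"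
    then show "\<forall>i\<in>{1..?K}. scalar_prod c (q i) = 0"
      using cq e qc by (metis less_irrefl mult_eq_0_iff scalar_prod_left_zero)
  next
    assume perp: "\<forall>i\<in>{1..?K}. scalar_prod c (q i) = 0"
    define d where "d = A *\<^sub>v c"
    have d: "d \<in> carrier_vec m" using A c by (simp add: d_def)
    have dq: "scalar_prod d (q i) = 0" if "i \<in> {1..?K}" for i
      using cq[OF that] perp that by (simp add: d_def)
    show "A *\<^sub>v c = 0\<^sub>v m"
    proof (rule ccontr)
      assume "A *\<^sub>v c \<noteq> 0\<^sub>v m"
      then have dd: "scalar_prod d d \<noteq> 0"
        using d conjugate_square_eq_0_vec[of d m] by (simp add: d_def)
      \<comment> \<open>the indices of \<open>q\<close> start from \<open>1\<close>, which leaves \<open>0\<close> for \<open>d\<close>\<close>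
      define g where "g = (\<lambda>i. if i = 0 then d else q i)"
      have g: "g i \<in> carrier_vec m" if "i \<in> {0..?K}" for i
        using that d qc by (auto simp: g_def)
      have orth: "scalar_prod (g i) (g j) = (if i = j then if i = 0 then scalar_prod d d else 1 else 0)"
        if "i \<in> {0..?K}" "j \<in> {0..?K}" for i j
      proof -
        have "scalar_prod (q t) d = 0" if "t \<in> {1..?K}" for t
          using dq[OF that] comm_scalar_prod[OF qc[OF that] d] by simp
        then show ?thesis
          using that dq on by (cases "i = 0"; cases "j = 0") (simp_all add: g_def)
      qed
      have li: "inj_on g {0..?K}" "lin_indpt (g ` {0..?K})"
        using lin_indpt_if_orthogonal[of "{0..?K}" g] g orth dd by auto
      have "g i \<in> col_space A" if i: "i \<in> {0..?K}" for i
      proof (cases "i = 0")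
        case True
        then show ?thesis using A c d unfolding col_space_eq[OF A] by (auto simp: g_def d_def)
      next
        case False
        then have i': "i \<in> {1..?K}" using i by auto
        have "A *\<^sub>v (inverse (e i) \<cdot>\<^sub>v q i) = q i"
          using A qc[OF i'] Aq[OF i'] e[OF i'] by (simp add: mult_mat_vec smult_smult_assoc)
        then show ?thesis using False A qc[OF i'] unfolding col_space_eq[OF A]
          by (auto simp: g_def intro!: bexI[of _ "inverse (e i) \<cdot>\<^sub>v q i"])
      qed
      then have "card (g ` {0..?K}) \<le> ?K"
        using card_le_rank_if_lin_indpt_in_col_space[OF A _ li(2)] unfolding K by (simp add: image_subset_iff)
      then show False using card_image[OF li(1)] by simp
    qed
  qed
qed

section \<open>Functions of class \<open>C\<^sup>k\<close>\<close>

lemma Ck_on_SucD: "Ck_on (Suc k) S f \<Longrightarrow> Ck_on k S f"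
proof (induction k arbitrary: f)
  case 0
  then show ?case
    by (auto intro!: differentiable_imp_continuous_on differentiable_at_imp_differentiable_on)
next
  case (Suc k)
  then show ?case by (metis Ck_on.simps(2))
qed

lemma Ck_on_subset: "Ck_on k S f \<Longrightarrow> T \<subseteq> S \<Longrightarrow> Ck_on k T f"
  by (induction k arbitrary: f) (auto intro: continuous_on_subset)

lemma Ck_on_cong:
  assumes "open S" and "\<And>x. x \<in> S \<Longrightarrow> f x = g x" and "Ck_on k S f"
  shows "Ck_on k S g"
  using assms(2,3)
proof (induction k arbitrary: f g)
  case 0
  then show ?case by (auto cong: continuous_on_cong)
next
  case (Suc k)
  have d: "(g has_derivative frechet_derivative f (at x)) (at x)" if "x \<in> S" for x
    using Suc.prems that assms(1)
    by (auto intro: has_derivative_transform_within_open simp: frechet_derivative_works)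
  then have "frechet_derivative f (at x) = frechet_derivative g (at x)" if "x \<in> S" for x
    using that frechet_derivative_at by blast
  then show ?case
    using Suc.prems d Suc.IH[of "\<lambda>x. frechet_derivative f (at x) v" "\<lambda>x. frechet_derivative g (at x) v" for v]
    by (auto intro!: differentiableI)
qed

lemma Ck_on_SucI:
  assumes "open S" and "\<And>x. x \<in> S \<Longrightarrow> (f has_derivative f' x) (at x)"
    and "\<And>v. Ck_on k S (\<lambda>x. f' x v)"
  shows "Ck_on (Suc k) S f"
proof -
  have eq: "f' x v = frechet_derivative f (at x) v" if "x \<in> S" for x v
    using frechet_derivative_at[OF assms(2)[OF that]] by simp
  have "Ck_on k S (\<lambda>x. frechet_derivative f (at x) v)" for v
    by (rule Ck_on_cong[OF assms(1) eq assms(3)])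
  then show ?thesis using assms(2) by (auto intro: differentiableI)
qed

lemma Ck_on_has_derivative:
  "Ck_on (Suc k) S f \<Longrightarrow> x \<in> S \<Longrightarrow> (f has_derivative frechet_derivative f (at x)) (at x)"
  by (simp add: frechet_derivative_works)

lemma Ck_on_const: "open S \<Longrightarrow> Ck_on k S (\<lambda>x. c)"
  by (induction k arbitrary: c) auto

lemma Ck_on_bounded_linear:
  assumes "open S" "bounded_linear L"
  shows "Ck_on k S f \<Longrightarrow> Ck_on k S (\<lambda>x. L (f x))"
proof (induction k arbitrary: f)
  case 0
  then show ?case
    using assms(2) by (auto intro: bounded_linear.continuous_on)
next
  case (Suc k)
  show ?case
    by (rule Ck_on_SucI[OF assms(1) bounded_linear.has_derivative[OF assms(2) Ck_on_has_derivative]])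
      (use Suc in auto)
qed

lemma Ck_on_add:
  assumes "open S"
  shows "Ck_on k S f \<Longrightarrow> Ck_on k S g \<Longrightarrow> Ck_on k S (\<lambda>x. f x + g x)"
proof (induction k arbitrary: f g)
  case 0
  then show ?case by (auto intro: continuous_on_add)
next
  case (Suc k)
  show ?case
    by (rule Ck_on_SucI[OF assms(1) has_derivative_add[OF Ck_on_has_derivative Ck_on_has_derivative]])
      (use Suc in auto)
qed

lemma Ck_on_sum:
  assumes "open S" "\<And>i. i \<in> I \<Longrightarrow> Ck_on k S (f i)"
  shows "Ck_on k S (\<lambda>x. \<Sum>i\<in>I. f i x)"
proof (cases "finite I")
  case True
  then show ?thesis using assms(2)
    by (induction I) (auto intro: Ck_on_add Ck_on_const assms(1))
next
  case False
  then show ?thesis by (simp add: Ck_on_const assms(1))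
qed

lemma Ck_on_scaleR:
  assumes "open S"
  shows "Ck_on k S f \<Longrightarrow> Ck_on k S g \<Longrightarrow> Ck_on k S (\<lambda>x. f x *\<^sub>R g x)"
proof (induction k arbitrary: f g)
  case 0
  then show ?case by (auto intro: continuous_on_scaleR)
next
  case (Suc k)
  show ?case
    by (rule Ck_on_SucI[OF assms(1) has_derivative_scaleR[OF Ck_on_has_derivative Ck_on_has_derivative]])
      (use Suc.prems Ck_on_SucD[OF Suc.prems(1)] Ck_on_SucD[OF Suc.prems(2)] in
        \<open>auto intro!: Ck_on_add assms(1) Suc.IH\<close>)
qed

lemma linear_basis_expansion:
  fixes F :: "'a::euclidean_space \<Rightarrow> 'b::real_vector"
  assumes "linear F"
  shows "F z = (\<Sum>b\<in>Basis. (z \<bullet> b) *\<^sub>R F b)"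
  by (metis (no_types, lifting) assms euclidean_representation linear_cmul linear_sum sum.cong)

lemma Ck_on_directional_derivative:
  fixes G :: "'a::euclidean_space \<Rightarrow> 'b::real_normed_vector"
  assumes W: "open W" and G: "Ck_on (Suc k) W G" and Z: "Ck_on k W Z"
  shows "Ck_on k W (\<lambda>q. frechet_derivative G (at q) (Z q))"
proof (rule Ck_on_cong[OF W])
  show "Ck_on k W (\<lambda>q. \<Sum>b\<in>Basis. (Z q \<bullet> b) *\<^sub>R frechet_derivative G (at q) b)"
    using G by (intro Ck_on_sum Ck_on_scaleR W Ck_on_bounded_linear[OF W bounded_linear_inner_left Z]) simp
  show "(\<Sum>b\<in>Basis. (Z q \<bullet> b) *\<^sub>R frechet_derivative G (at q) b) = frechet_derivative G (at q) (Z q)"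
    if "q \<in> W" for q
    using G that by (subst (2) linear_basis_expansion) (auto intro: linear_frechet_derivative)
qed

section \<open>Symmetry of second derivatives\<close>

lemma DERIV_along_line:
  fixes f :: "'a::real_normed_vector \<Rightarrow> real"
  assumes "(f has_derivative F) (at (a + s *\<^sub>R u))"
  shows "((\<lambda>s. f (a + s *\<^sub>R u)) has_real_derivative F u) (at s)"
proof -
  have l: "((\<lambda>s. a + s *\<^sub>R u) has_derivative (\<lambda>h. h *\<^sub>R u)) (at s)"
    by (auto intro!: derivative_eq_intros)
  have "((\<lambda>s. f (a + s *\<^sub>R u)) has_derivative (\<lambda>h. F (h *\<^sub>R u))) (at s)"
    using diff_chain_at[OF l assms] by (simp add: o_def)
  then show ?thesis
    using linear_cmul[OF has_derivative_linear[OF assms]]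
    by (simp add: has_field_derivative_def mult.commute[of _ "F u"])
qed

text \<open>Two applications of the mean value theorem, first in the direction \<open>u\<close>, then in the
  direction \<open>v\<close>. As the left-hand side is symmetric in \<open>u\<close> and \<open>v\<close>, the two mixed second derivatives
  agree at nearby points; continuity then makes them equal at \<open>p\<close>.\<close>

lemma second_difference_mean_value:
  fixes f :: "'a::real_normed_vector \<Rightarrow> real"
  assumes f: "\<And>q. q \<in> ball p d \<Longrightarrow> (f has_derivative F q) (at q)"
    and g: "\<And>q. q \<in> ball p d \<Longrightarrow> ((\<lambda>q. F q u) has_derivative G q) (at q)"
    and h: "0 < h" "h * (norm u + norm v) < d"
  shows "\<exists>q\<in>ball p d. f (p + h *\<^sub>R u + h *\<^sub>R v) - f (p + h *\<^sub>R u) - f (p + h *\<^sub>R v) + f p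
           = h * h * G q v"
proof -
  have inb: "p + s *\<^sub>R u + t *\<^sub>R v \<in> ball p d" if "0 \<le> s" "s \<le> h" "0 \<le> t" "t \<le> h" for s t
  proof -
    have "norm (s *\<^sub>R u + t *\<^sub>R v) \<le> s * norm u + t * norm v"
      using norm_triangle_ineq[of "s *\<^sub>R u" "t *\<^sub>R v"] that by simp
    also have "\<dots> \<le> h * norm u + h * norm v"
      using that by (intro add_mono mult_right_mono) auto
    also have "\<dots> < d" using h by (simp add: algebra_simps)
    finally show ?thesis using norm_minus_cancel[of "s *\<^sub>R u + t *\<^sub>R v"] by (simp add: dist_norm algebra_simps)
  qed
  have 1: "((\<lambda>s. f (p + t *\<^sub>R v + s *\<^sub>R u)) has_real_derivative F (p + s *\<^sub>R u + t *\<^sub>R v) u) (at s)"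
    if "0 \<le> s" "s \<le> h" "0 \<le> t" "t \<le> h" for s t
    by (rule DERIV_along_line) (use f inb[OF that] in \<open>simp add: algebra_simps\<close>)
  have 2: "((\<lambda>t. F (p + s *\<^sub>R u + t *\<^sub>R v) u) has_real_derivative G (p + s *\<^sub>R u + t *\<^sub>R v) v) (at t)"
    if "0 \<le> s" "s \<le> h" "0 \<le> t" "t \<le> h" for s t
    by (rule DERIV_along_line) (rule g[OF inb[OF that]])
  have "\<exists>s>0. s < h \<and>
      (f (p + h *\<^sub>R v + h *\<^sub>R u) - f (p + 0 *\<^sub>R v + h *\<^sub>R u))
        - (f (p + h *\<^sub>R v + 0 *\<^sub>R u) - f (p + 0 *\<^sub>R v + 0 *\<^sub>R u)) =
      (h - 0) * (F (p + s *\<^sub>R u + h *\<^sub>R v) u - F (p + s *\<^sub>R u + 0 *\<^sub>R v) u)"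
    using h by (intro MVT2 DERIV_diff 1) auto
  then obtain s where s: "0 < s" "s < h"
    "f (p + h *\<^sub>R v + h *\<^sub>R u) - f (p + h *\<^sub>R u) - f (p + h *\<^sub>R v) + f p =
      h * (F (p + s *\<^sub>R u + h *\<^sub>R v) u - F (p + s *\<^sub>R u + 0 *\<^sub>R v) u)"
    by auto
  have "\<exists>t>0. t < h \<and> F (p + s *\<^sub>R u + h *\<^sub>R v) u - F (p + s *\<^sub>R u + 0 *\<^sub>R v) u
      = (h - 0) * G (p + s *\<^sub>R u + t *\<^sub>R v) v"
    using h s by (intro MVT2 2) auto
  then obtain t where t: "0 < t" "t < h"
    "F (p + s *\<^sub>R u + h *\<^sub>R v) u - F (p + s *\<^sub>R u + 0 *\<^sub>R v) u = h * G (p + s *\<^sub>R u + t *\<^sub>R v) v"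
    by auto
  show ?thesis
    using inb[of s t] s t by (intro bexI[of _ "p + s *\<^sub>R u + t *\<^sub>R v"]) (auto simp: algebra_simps)
qed

lemma second_derivative_symmetric_real:
  fixes f :: "'a::real_normed_vector \<Rightarrow> real"
  assumes W: "open W" and p: "p \<in> W" and f: "Ck_on 2 W f"
  shows "frechet_derivative (\<lambda>q. frechet_derivative f (at q) u) (at p) v =
         frechet_derivative (\<lambda>q. frechet_derivative f (at q) v) (at p) u"
proof -
  define D where "D = (\<lambda>a b q. frechet_derivative (\<lambda>q. frechet_derivative f (at q) a) (at q) b)"
  have f1: "(f has_derivative frechet_derivative f (at q)) (at q)" if "q \<in> W" for q
    using f that by (simp add: numeral_2_eq_2 frechet_derivative_works)
  have f2: "((\<lambda>q. frechet_derivative f (at q) a) has_derivative (\<lambda>b. D a b q)) (at q)" if "q \<in> W" for q a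
    using f that by (simp add: numeral_2_eq_2 frechet_derivative_works D_def)
  have cont: "continuous_on W (D a b)" for a b
    using f by (simp add: numeral_2_eq_2 D_def)
  have "D u v p = D v u p"
  proof (rule ccontr)
    assume ne: "D u v p \<noteq> D v u p"
    define e where "e = \<bar>D u v p - D v u p\<bar> / 2"
    have e: "e > 0" using ne by (simp add: e_def)
    have "continuous (at p) (D u v)" "continuous (at p) (D v u)"
      using cont W p continuous_on_eq_continuous_at by blast+
    then obtain d1 d2 where d1: "d1 > 0" "\<And>q. dist q p < d1 \<Longrightarrow> dist (D u v q) (D u v p) < e"
      and d2: "d2 > 0" "\<And>q. dist q p < d2 \<Longrightarrow> dist (D v u q) (D v u p) < e"
      using e unfolding continuous_at_eps_delta by metis
    obtain d0 where d0: "d0 > 0" "ball p d0 \<subseteq> W" using W p open_contains_ball by blast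
    define d where "d = min d0 (min d1 d2)"
    have d: "d > 0" "ball p d \<subseteq> W" using d0 d1 d2 by (auto simp: d_def)
    define h where "h = d / (2 * (norm u + norm v + 1))"
    have pos: "norm u + norm v + 1 > 0" by (simp add: add_nonneg_pos)
    have h: "h > 0" using pos d by (simp add: h_def)
    have "h * (norm u + norm v) < h * (2 * (norm u + norm v + 1))"
      using h pos by (intro mult_strict_left_mono) auto
    also have "\<dots> = d" using pos by (simp add: h_def)
    finally have hd: "h * (norm u + norm v) < d" .
    have hd': "h * (norm v + norm u) < d" using hd by (simp add: add.commute)
    obtain q where q: "q \<in> ball p d" "f (p + h *\<^sub>R u + h *\<^sub>R v) - f (p + h *\<^sub>R u) - f (p + h *\<^sub>R v) + f p
        = h * h * D u v q"
      using second_difference_mean_value[where f=f and d=d, OF f1 f2 h hd] d by blast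
    obtain q' where q': "q' \<in> ball p d" "f (p + h *\<^sub>R v + h *\<^sub>R u) - f (p + h *\<^sub>R v) - f (p + h *\<^sub>R u) + f p
        = h * h * D v u q'"
      using second_difference_mean_value[where f=f and d=d, OF f1 f2 h hd'] d by blast
    have "h * h * D u v q = h * h * D v u q'"
      unfolding q(2)[symmetric] q'(2)[symmetric] by (simp add: algebra_simps)
    then have eq: "D u v q = D v u q'" using h by simp
    have "dist (D u v q) (D u v p) < e" "dist (D v u q') (D v u p) < e"
      using q(1) q'(1) using d1(2)[of q] d2(2)[of q'] by (auto simp: d_def dist_commute)
    then show False using eq by (simp add: e_def dist_real_def abs_if split: if_splits)
  qed
  then show ?thesis by (simp add: D_def)
qed

lemma second_derivative_symmetric:
  fixes g :: "'a::real_normed_vector \<Rightarrow> 'b::euclidean_space"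
  assumes W: "open W" and p: "p \<in> W" and g: "Ck_on 2 W g"
  shows "frechet_derivative (\<lambda>q. frechet_derivative g (at q) u) (at p) v =
         frechet_derivative (\<lambda>q. frechet_derivative g (at q) v) (at p) u"
proof (rule euclidean_eqI)
  fix e :: 'b assume "e \<in> Basis"
  have L: "bounded_linear (\<lambda>x::'b. x \<bullet> e)" by (rule bounded_linear_inner_left)
  have g1: "(g has_derivative frechet_derivative g (at q)) (at q)" if "q \<in> W" for q
    using g that by (simp add: numeral_2_eq_2 frechet_derivative_works)
  have g2: "((\<lambda>q. frechet_derivative g (at q) a) has_derivative
      frechet_derivative (\<lambda>q. frechet_derivative g (at q) a) (at p)) (at p)" for a
    using g p by (simp add: numeral_2_eq_2 frechet_derivative_works)
  have 1: "frechet_derivative g (at q) a \<bullet> e = frechet_derivative (\<lambda>q. g q \<bullet> e) (at q) a" if "q \<in> W" for q a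
    using frechet_derivative_at[OF bounded_linear.has_derivative[OF L g1[OF that]]] by (rule fun_cong)
  have 2: "frechet_derivative (\<lambda>q. frechet_derivative g (at q) a) (at p) b \<bullet> e =
      frechet_derivative (\<lambda>q. frechet_derivative (\<lambda>q. g q \<bullet> e) (at q) a) (at p) b" for a b
  proof -
    have "((\<lambda>q. frechet_derivative (\<lambda>q. g q \<bullet> e) (at q) a) has_derivative
        (\<lambda>b. frechet_derivative (\<lambda>q. frechet_derivative g (at q) a) (at p) b \<bullet> e)) (at p)"
      by (rule has_derivative_transform_within_open[OF bounded_linear.has_derivative[OF L g2] W p]) (rule 1)
    from fun_cong[OF frechet_derivative_at[OF this]] show ?thesis .
  qed
  show "frechet_derivative (\<lambda>q. frechet_derivative g (at q) u) (at p) v \<bullet> e =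
      frechet_derivative (\<lambda>q. frechet_derivative g (at q) v) (at p) u \<bullet> e"
    unfolding 2 by (rule second_derivative_symmetric_real[OF W p Ck_on_bounded_linear[OF W L g]])
qed

text \<open>By the chain rule, differentiating \<open>G' (Z)\<close> along \<open>X\<close> gives \<open>G'' (X, Z) + G' (Z' (X))\<close>; the second
  order terms cancel in the commutator.\<close>

lemma commutator_directional_derivatives:
  fixes G :: "'a::euclidean_space \<Rightarrow> 'b::euclidean_space"
  assumes W: "open W" and p: "p \<in> W" and G: "Ck_on 2 W G" and X: "Ck_on 1 W X" and Z: "Ck_on 1 W Z"
  shows "frechet_derivative (\<lambda>q. frechet_derivative G (at q) (Z q)) (at p) (X p)
       - frechet_derivative (\<lambda>q. frechet_derivative G (at q) (X q)) (at p) (Z p)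
       = frechet_derivative G (at p) (frechet_derivative Z (at p) (X p) - frechet_derivative X (at p) (Z p))"
proof -
  define B where "B = (\<lambda>b v. frechet_derivative (\<lambda>q. frechet_derivative G (at q) b) (at p) v)"
  have linG: "linear (frechet_derivative G (at q))" if "q \<in> W" for q
    using G that by (simp add: numeral_2_eq_2 linear_frechet_derivative)
  have dB: "((\<lambda>q. frechet_derivative G (at q) b) has_derivative B b) (at p)" for b
    using G p by (simp add: numeral_2_eq_2 frechet_derivative_works B_def)
  have linB: "linear (B b)" for b using has_derivative_linear[OF dB] .
  have eq: "frechet_derivative (\<lambda>q. frechet_derivative G (at q) (Z q)) (at p) v =
      frechet_derivative G (at p) (frechet_derivative Z (at p) v) + (\<Sum>b\<in>Basis. (Z p \<bullet> b) *\<^sub>R B b v)"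
    if Z: "Ck_on 1 W Z" for Z v
  proof -
    have dZ: "(Z has_derivative frechet_derivative Z (at p)) (at p)"
      using Z p by (simp add: frechet_derivative_works)
    have "((\<lambda>q. \<Sum>b\<in>Basis. (Z q \<bullet> b) *\<^sub>R frechet_derivative G (at q) b) has_derivative
        (\<lambda>v. \<Sum>b\<in>Basis. (Z p \<bullet> b) *\<^sub>R B b v +
              (frechet_derivative Z (at p) v \<bullet> b) *\<^sub>R frechet_derivative G (at p) b)) (at p)"
      by (intro has_derivative_sum has_derivative_scaleR dB
          bounded_linear.has_derivative[OF bounded_linear_inner_left dZ])
    then have "((\<lambda>q. frechet_derivative G (at q) (Z q)) has_derivative
        (\<lambda>v. \<Sum>b\<in>Basis. (Z p \<bullet> b) *\<^sub>R B b v +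
              (frechet_derivative Z (at p) v \<bullet> b) *\<^sub>R frechet_derivative G (at p) b)) (at p)"
      by (rule has_derivative_transform_within_open[OF _ W p])
        (rule linear_basis_expansion[OF linG, symmetric])
    from fun_cong[OF frechet_derivative_at[OF this], of v] show ?thesis
      using linear_basis_expansion[OF linG[OF p], of "frechet_derivative Z (at p) v"]
      by (simp add: sum.distrib add.commute)
  qed
  have B_sym: "B b c = B c b" for b c
    unfolding B_def by (rule second_derivative_symmetric[OF W p G])
  have expand: "(\<Sum>b\<in>Basis. (u \<bullet> b) *\<^sub>R B b v) = (\<Sum>b\<in>Basis. \<Sum>c\<in>Basis. ((u \<bullet> b) * (v \<bullet> c)) *\<^sub>R B b c)"
    for u v
    by (subst linear_basis_expansion[OF linB, of _ v]) (simp add: scaleR_sum_right)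
  have "(\<Sum>b\<in>Basis. (Z p \<bullet> b) *\<^sub>R B b (X p)) = (\<Sum>b\<in>Basis. \<Sum>c\<in>Basis. ((Z p \<bullet> b) * (X p \<bullet> c)) *\<^sub>R B c b)"
    unfolding expand by (intro sum.cong refl arg_cong2[where f = scaleR] B_sym)
  also have "\<dots> = (\<Sum>c\<in>Basis. (X p \<bullet> c) *\<^sub>R B c (Z p))"
    unfolding expand by (subst sum.swap) (simp only: mult.commute)
  finally have sym: "(\<Sum>b\<in>Basis. (Z p \<bullet> b) *\<^sub>R B b (X p)) = (\<Sum>b\<in>Basis. (X p \<bullet> b) *\<^sub>R B b (Z p))" .
  show ?thesis
    unfolding eq[OF Z] eq[OF X] sym by (simp add: linear_diff[OF linG[OF p]])
qed

section \<open>Derivatives along a submanifold\<close>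

text \<open>Composition with a curve in \<open>M\<close> with velocity \<open>v\<close> determines the derivative on \<open>v\<close>, although \<open>M\<close>
  may be too thin to determine it elsewhere. This makes the choice hidden in \<open>nabla\<close> harmless and lets
  all computations be done with smooth extensions to open sets.\<close>

lemma has_derivative_unique_on_tangent_space:
  fixes f :: "'a::euclidean_space \<Rightarrow> 'b::real_normed_vector"
  assumes v: "v \<in> tangent_space M p"
    and D: "(f has_derivative D) (at p within M)" and D': "(f has_derivative D') (at p within M)"
  shows "D v = D' v"
proof -
  obtain \<gamma> e where \<gamma>: "0 < e" "\<gamma> ` {-e<..<e::real} \<subseteq> M" "\<gamma> 0 = p" "(\<gamma> has_vector_derivative v) (at 0)"
    using v unfolding tangent_space_def by auto
  have "((f \<circ> \<gamma>) has_vector_derivative E v) (at 0)" if E: "(f has_derivative E) (at p within M)" for E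
  proof -
    have "(\<gamma> has_derivative (\<lambda>h. h *\<^sub>R v)) (at 0 within {-e<..<e})"
      using \<gamma>(4) unfolding has_vector_derivative_def by (rule has_derivative_at_withinI)
    moreover have "(f has_derivative E) (at (\<gamma> 0) within \<gamma> ` {-e<..<e})"
      using has_derivative_subset[OF E \<gamma>(2)] \<gamma>(3) by simp
    ultimately have "((f \<circ> \<gamma>) has_derivative (E \<circ> (\<lambda>h. h *\<^sub>R v))) (at 0 within {-e<..<e})"
      by (rule diff_chain_within)
    then show ?thesis
      using \<gamma>(1) linear_cmul[OF has_derivative_linear[OF E]]
      by (simp add: has_vector_derivative_def at_within_open[of 0 "{-e<..<e}"] o_def)
  qed
  then show ?thesis using D D' vector_derivative_unique_at by blast
qed

lemma frechet_derivative_within_eq_extension: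
  fixes V :: "'a::euclidean_space \<Rightarrow> 'b::real_normed_vector"
  assumes g: "(g has_derivative G) (at p)" and W: "open W" "p \<in> W" and p: "p \<in> M"
    and eq: "\<And>q. q \<in> M \<inter> W \<Longrightarrow> g q = V q"
  shows "(V has_derivative frechet_derivative V (at p within M)) (at p within M)"
    and "v \<in> tangent_space M p \<Longrightarrow> frechet_derivative V (at p within M) v = G v"
proof -
  obtain d where d: "d > 0" "ball p d \<subseteq> W" using W open_contains_ball by blast
  have G: "(V has_derivative G) (at p within M)"
    by (rule has_derivative_transform_within[OF has_derivative_at_withinI[OF g] d(1) p])
      (use d eq in \<open>auto simp: dist_commute subset_eq\<close>)
  then show V: "(V has_derivative frechet_derivative V (at p within M)) (at p within M)"
    using differentiableI frechet_derivative_works by blast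
  show "v \<in> tangent_space M p \<Longrightarrow> frechet_derivative V (at p within M) v = G v"
    using has_derivative_unique_on_tangent_space[OF _ V G] .
qed

lemma smooth_on_extension:
  assumes "smooth_on (M \<inter> U) V" "open U" "p \<in> M \<inter> U"
  obtains W g where "open W" "p \<in> W" "W \<subseteq> U" "\<And>k. Ck_on k W g" "\<And>q. q \<in> M \<inter> W \<Longrightarrow> g q = V q"
proof -
  obtain W g where W: "open W" "p \<in> W" "\<And>k. Ck_on k W g" "\<And>q. q \<in> M \<inter> U \<inter> W \<Longrightarrow> g q = V q"
    using assms unfolding smooth_on_def by metis
  show ?thesis
  proof (rule that[of "W \<inter> U" g])
    show "Ck_on k (W \<inter> U) g" for k using W(3) by (rule Ck_on_subset) simp
  qed (use W assms in auto)
qed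

lemma smooth_on_has_derivative:
  fixes V :: "'a::euclidean_space \<Rightarrow> 'b::real_normed_vector"
  assumes "smooth_on (M \<inter> U) V" "open U" "p \<in> M \<inter> U"
  shows "(V has_derivative frechet_derivative V (at p within M)) (at p within M)"
proof -
  obtain W g where W: "open W" "p \<in> W" "W \<subseteq> U" "\<And>k. Ck_on k W g" "\<And>q. q \<in> M \<inter> W \<Longrightarrow> g q = V q"
    using smooth_on_extension[OF assms] by blast
  from frechet_derivative_within_eq_extension(1)[OF Ck_on_has_derivative[OF W(4) W(2)] W(1,2) _ W(5)]
  show ?thesis using assms(3) by blast
qed

lemma smooth_on_diff:
  assumes "smooth_on A f" "smooth_on A g"
  shows "smooth_on A (\<lambda>q. f q - g q)"
  unfolding smooth_on_def
proof
  fix p assume p: "p \<in> A"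
  obtain W1 f' where f': "open W1" "p \<in> W1" "\<And>k. Ck_on k W1 f'" "\<And>q. q \<in> A \<inter> W1 \<Longrightarrow> f' q = f q"
    using assms(1) p unfolding smooth_on_def by metis
  obtain W2 g' where g': "open W2" "p \<in> W2" "\<And>k. Ck_on k W2 g'" "\<And>q. q \<in> A \<inter> W2 \<Longrightarrow> g' q = g q"
    using assms(2) p unfolding smooth_on_def by metis
  have o: "open (W1 \<inter> W2)" using f' g' by auto
  have "Ck_on k (W1 \<inter> W2) (\<lambda>q. f' q + - g' q)" for k
    by (rule Ck_on_add[OF o Ck_on_subset[OF f'(3)]
          Ck_on_bounded_linear[OF o bounded_linear_minus[OF bounded_linear_ident] Ck_on_subset[OF g'(3)]]]) auto
  then show "\<exists>W h. open W \<and> p \<in> W \<and> (\<forall>k. Ck_on k W h) \<and> (\<forall>q\<in>A \<inter> W. h q = f q - g q)"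
    using o f' g' by (intro exI[of _ "W1 \<inter> W2"] exI[of _ "\<lambda>q. f' q + - g' q"]) auto
qed

lemma nabla_eq_extension:
  fixes V :: "'a::euclidean_space \<Rightarrow> 'a"
  assumes "Ck_on (Suc k) W g" "open W" "p \<in> M \<inter> W" "\<And>q. q \<in> M \<inter> W \<Longrightarrow> g q = V q"
    and "Z p \<in> tangent_space M p"
  shows "nabla M Z V p = frechet_derivative g (at p) (Z p)"
  using frechet_derivative_within_eq_extension(2)[OF Ck_on_has_derivative[OF assms(1)]] assms(2-)
  unfolding nabla_def by blast

lemma smooth_on_nabla:
  fixes V :: "'a::euclidean_space \<Rightarrow> 'a"
  assumes U: "open U" and V: "smooth_on (M \<inter> U) V" and Z: "smooth_on (M \<inter> U) Z"
    and tan: "\<And>q. q \<in> M \<inter> U \<Longrightarrow> Z q \<in> tangent_space M q"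
  shows "smooth_on (M \<inter> U) (nabla M Z V)"
  unfolding smooth_on_def
proof
  fix p assume p: "p \<in> M \<inter> U"
  obtain W1 g where g: "open W1" "p \<in> W1" "W1 \<subseteq> U" "\<And>k. Ck_on k W1 g" "\<And>q. q \<in> M \<inter> W1 \<Longrightarrow> g q = V q"
    using smooth_on_extension[OF V U p] by blast
  obtain W2 z where z: "open W2" "p \<in> W2" "W2 \<subseteq> U" "\<And>k. Ck_on k W2 z" "\<And>q. q \<in> M \<inter> W2 \<Longrightarrow> z q = Z q"
    using smooth_on_extension[OF Z U p] by blast
  have o: "open (W1 \<inter> W2)" using g z by auto
  have "Ck_on k (W1 \<inter> W2) (\<lambda>q. frechet_derivative g (at q) (z q))" for k
    by (intro Ck_on_directional_derivative o Ck_on_subset[OF g(4)] Ck_on_subset[OF z(4)]) auto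
  moreover have "frechet_derivative g (at q) (z q) = nabla M Z V q" if "q \<in> (M \<inter> U) \<inter> (W1 \<inter> W2)" for q
    using nabla_eq_extension[OF g(4,1) _ g(5), where p = q and Z = Z] tan z(5) that by auto
  ultimately show "\<exists>W h. open W \<and> p \<in> W \<and> (\<forall>k. Ck_on k W h) \<and> (\<forall>q\<in>M \<inter> U \<inter> W. h q = nabla M Z V q)"
    using o g z by (intro exI[of _ "W1 \<inter> W2"] exI[of _ "\<lambda>q. frechet_derivative g (at q) (z q)"]) auto
qed

lemma nabla_cong:
  assumes "open U" "p \<in> M \<inter> U" "\<And>q. q \<in> M \<inter> U \<Longrightarrow> V q = V' q"
  shows "nabla M Z V p = nabla M Z V' p"
proof -
  obtain d where d: "d > 0" "ball p d \<subseteq> U" using assms open_contains_ball by blast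
  have "(V has_derivative D) (at p within M) \<longleftrightarrow> (V' has_derivative D) (at p within M)" for D
    using has_derivative_transform_within[OF _ d(1), of V D p M V']
      has_derivative_transform_within[OF _ d(1), of V' D p M V] d(2) assms(2,3)
    by (auto simp: dist_commute subset_eq)
  then show ?thesis unfolding nabla_def frechet_derivative_def by simp
qed

lemma nabla_diff:
  assumes "smooth_on (M \<inter> U) V" "smooth_on (M \<inter> U) V'" "open U" "p \<in> M \<inter> U" "Z p \<in> tangent_space M p"
  shows "nabla M Z (\<lambda>q. V q - V' q) p = nabla M Z V p - nabla M Z V' p"
  unfolding nabla_def
  by (rule has_derivative_unique_on_tangent_space[OF assms(5)])
    (rule smooth_on_has_derivative[OF smooth_on_diff[OF assms(1,2)] assms(3,4)]
      has_derivative_diff[OF smooth_on_has_derivative[OF assms(1,3,4)] smooth_on_has_derivative[OF assms(2,3,4)]])+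

lemma nabla_zero:
  assumes "p \<in> M" "Z p \<in> tangent_space M p"
  shows "nabla M Z (\<lambda>q. 0) p = 0"
  using nabla_eq_extension[of 0 UNIV "\<lambda>q. 0" p M "\<lambda>q. 0" Z] Ck_on_const[of UNIV "Suc 0" 0] assms by auto

text \<open>The product rule for the vanishing function \<open>V \<bullet> F\<close> on \<open>M\<close>.\<close>

lemma inner_nabla_eq_if_orthogonal:
  assumes "smooth_on (M \<inter> U) V" "smooth_on (M \<inter> U) F" "open U" "p \<in> M \<inter> U" "Z p \<in> tangent_space M p"
    and orth: "\<And>q. q \<in> M \<inter> U \<Longrightarrow> V q \<bullet> F q = 0"
  shows "nabla M Z V p \<bullet> F p = - (V p \<bullet> nabla M Z F p)"
proof -
  obtain d where d: "d > 0" "ball p d \<subseteq> U" using assms open_contains_ball by blast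
  have "((\<lambda>q. V q \<bullet> F q) has_derivative (\<lambda>v. V p \<bullet> frechet_derivative F (at p within M) v +
      frechet_derivative V (at p within M) v \<bullet> F p)) (at p within M)"
    by (rule has_derivative_inner[OF smooth_on_has_derivative[OF assms(1,3,4)] smooth_on_has_derivative[OF assms(2,3,4)]])
  moreover have "((\<lambda>q. V q \<bullet> F q) has_derivative (\<lambda>v. 0)) (at p within M)"
    by (rule has_derivative_transform_within[OF has_derivative_const d(1)])
      (use assms d in \<open>auto simp: dist_commute subset_eq\<close>)
  ultimately have "V p \<bullet> frechet_derivative F (at p within M) (Z p) +
      frechet_derivative V (at p within M) (Z p) \<bullet> F p = 0"
    by (rule has_derivative_unique_on_tangent_space[OF assms(5)])
  then show ?thesis by (simp add: nabla_def)
qed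

text \<open>The derivative of the extension \<open>G\<close> appears on the right because the bracket is not yet
  known to be tangent to \<open>M\<close>; this form is what proves tangency below.\<close>

lemma nabla_commutator_extension:
  fixes V :: "'a::euclidean_space \<Rightarrow> 'a"
  assumes U: "open U" and W: "open W" "W \<subseteq> U" and p: "p \<in> M \<inter> W"
    and G: "\<And>k. Ck_on k W G" and GV: "\<And>q. q \<in> M \<inter> W \<Longrightarrow> G q = V q"
    and X: "smooth_on (M \<inter> U) X" "\<And>q. q \<in> M \<inter> U \<Longrightarrow> X q \<in> tangent_space M q"
    and Z: "smooth_on (M \<inter> U) Z" "\<And>q. q \<in> M \<inter> U \<Longrightarrow> Z q \<in> tangent_space M q"
  shows "nabla M X (nabla M Z V) p - nabla M Z (nabla M X V) p =
    frechet_derivative G (at p) (nabla M X Z p - nabla M Z X p)"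
proof -
  have pU: "p \<in> M \<inter> U" using p W by auto
  obtain W1 x where x: "open W1" "p \<in> W1" "W1 \<subseteq> U" "\<And>k. Ck_on k W1 x" "\<And>q. q \<in> M \<inter> W1 \<Longrightarrow> x q = X q"
    using smooth_on_extension[OF X(1) U pU] by blast
  obtain W2 z where z: "open W2" "p \<in> W2" "W2 \<subseteq> U" "\<And>k. Ck_on k W2 z" "\<And>q. q \<in> M \<inter> W2 \<Longrightarrow> z q = Z q"
    using smooth_on_extension[OF Z(1) U pU] by blast
  define S where "S = W \<inter> W1 \<inter> W2"
  have S: "open S" "p \<in> M \<inter> S"
    using W x z p by (auto simp: S_def)
  have GS: "Ck_on k S G" and xS: "Ck_on k S x" and zS: "Ck_on k S z" for k
    by (rule Ck_on_subset[OF G] Ck_on_subset[OF x(4)] Ck_on_subset[OF z(4)], force simp: S_def)+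
  have second: "nabla M A (nabla M B V) p =
      frechet_derivative (\<lambda>q. frechet_derivative G (at q) (b q)) (at p) (A p)"
    if B: "\<And>q. q \<in> M \<inter> U \<Longrightarrow> B q \<in> tangent_space M q" and A: "A p \<in> tangent_space M p"
      and b: "\<And>k. Ck_on k S b" "\<And>q. q \<in> M \<inter> S \<Longrightarrow> b q = B q" for A B b
  proof (rule nabla_eq_extension[OF Ck_on_directional_derivative[OF S(1) GS b(1)] S])
    fix q assume q: "q \<in> M \<inter> S"
    then have "nabla M B V q = frechet_derivative G (at q) (B q)"
      using W by (intro nabla_eq_extension[OF GS S(1) q] GV B) (auto simp: S_def)
    then show "frechet_derivative G (at q) (b q) = nabla M B V q" using b(2)[OF q] by simp
  qed (rule A)
  have "nabla M X Z p = frechet_derivative z (at p) (X p)"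
    using X pU by (intro nabla_eq_extension[OF zS S]) (auto simp: S_def z)
  moreover have "nabla M Z X p = frechet_derivative x (at p) (Z p)"
    using Z pU by (intro nabla_eq_extension[OF xS S]) (auto simp: S_def x)
  moreover have "nabla M X (nabla M Z V) p =
      frechet_derivative (\<lambda>q. frechet_derivative G (at q) (z q)) (at p) (X p)"
    by (rule second) (use X Z pU zS z(5) in \<open>auto simp: S_def\<close>)
  moreover have "nabla M Z (nabla M X V) p =
      frechet_derivative (\<lambda>q. frechet_derivative G (at q) (x q)) (at p) (Z p)"
    by (rule second) (use X Z pU xS x(5) in \<open>auto simp: S_def\<close>)
  moreover have "x p = X p" "z p = Z p" using x z p by auto
  ultimately show ?thesis
    using commutator_directional_derivatives[OF S(1) _ GS xS[of 1] zS[of 1], of p] S by simp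
qed

lemma orthonormal_family:
  fixes f :: "'i \<Rightarrow> 'a::euclidean_space"
  assumes "finite I" and "\<And>i j. i \<in> I \<Longrightarrow> j \<in> I \<Longrightarrow> f i \<bullet> f j = (if i = j then 1 else 0)"
  shows "inj_on f I" and "independent (f ` I)" and "dim (span (f ` I)) = card I"
proof -
  show inj: "inj_on f I"
    by (rule inj_onI) (metis assms(2) zero_neq_one)
  have "pairwise orthogonal (f ` I)"
    using assms(2) by (auto simp: pairwise_def orthogonal_def) 
  moreover have "0 \<notin> f ` I" using assms(2) by fastforce
  ultimately show ind: "independent (f ` I)" by (rule pairwise_orthogonal_independent)
  show "dim (span (f ` I)) = card I"
    using dim_eq_card_independent[OF ind] card_image[OF inj] by (simp add: dim_span)
qed

text \<open>In a chart \<open>\<phi>\<close> that maps \<open>M\<close> into the subspace \<open>E\<close>, the functions \<open>\<phi> \<bullet> e\<close>, \<open>e\<close> orthogonal to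
  \<open>E\<close>, vanish on \<open>M\<close>, and so do their derivatives along \<open>M\<close>. By the commutator formula they are
  stationary in the direction of the bracket as well as of the \<open>Y k\<close>. The directions in which all of
  them are stationary form a space of dimension at most \<open>n\<close>, since the derivative of \<open>\<phi>\<close> is injective and
  takes this space into \<open>E\<close>; hence the \<open>Y k\<close> span it.\<close>

lemma bracket_in_span_frame:
  fixes M U :: "'a::euclidean_space set"
  assumes M: "submanifold n M" and U: "open U" and p: "p \<in> M \<inter> U"
    and Y: "orthonormal_tangent_frame n M U Y" and ij: "i \<in> {1..n}" "j \<in> {1..n}"
  shows "nabla M (Y i) (Y j) p - nabla M (Y j) (Y i) p \<in> span ((\<lambda>k. Y k p) ` {1..n})"
proof -
  have Ysm: "smooth_on (M \<inter> U) (Y k)" and Ytan: "q \<in> M \<inter> U \<Longrightarrow> Y k q \<in> tangent_space M q"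
    if "k \<in> {1..n}" for k q
    using Y that unfolding orthonormal_tangent_frame_def by auto
  have Yon: "Y k p \<bullet> Y l p = (if k = l then 1 else 0)" if "k \<in> {1..n}" "l \<in> {1..n}" for k l
    using Y that p unfolding orthonormal_tangent_frame_def by blast
  obtain A B \<phi> \<psi> and E :: "'a set" where ch: "open A" "p \<in> A" "open B" "homeomorphism A B \<phi> \<psi>"
      "smooth_on A \<phi>" "smooth_on B \<psi>" "Real_Vector_Spaces.subspace E" "dim E = n" "\<phi> ` (M \<inter> A) = E \<inter> B"
    using M p unfolding submanifold_def by (metis IntD1)
  obtain W g where g: "open W" "p \<in> W" "W \<subseteq> A" "\<And>k. Ck_on k W g" "\<And>q. q \<in> UNIV \<inter> W \<Longrightarrow> g q = \<phi> q"
    using smooth_on_extension[of UNIV A \<phi> p] ch by auto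
  have \<phi>B: "\<phi> p \<in> B" using ch unfolding homeomorphism_def by auto
  obtain W' h where h: "open W'" "\<phi> p \<in> W'" "W' \<subseteq> B" "\<And>k. Ck_on k W' h" "\<And>q. q \<in> UNIV \<inter> W' \<Longrightarrow> h q = \<psi> q"
    using smooth_on_extension[of UNIV B \<psi> "\<phi> p"] ch \<phi>B by auto
  define S where "S = W \<inter> U"
  have S: "open S" "p \<in> M \<inter> S" "S \<subseteq> U" using g U p by (auto simp: S_def)
  have gS: "Ck_on k S g" for k using g(4) by (rule Ck_on_subset) (simp add: S_def)
  define F where "F = frechet_derivative g (at p)"
  have F: "(g has_derivative F) (at p)" unfolding F_def by (rule Ck_on_has_derivative[OF g(4) g(2)])
  have inj: "inj F"
  proof -
    have gp: "g p = \<phi> p" using g by auto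
    have "(h has_derivative frechet_derivative h (at (g p))) (at (g p))"
      using h gp by (metis Ck_on_has_derivative)
    then have comp: "((h \<circ> g) has_derivative (frechet_derivative h (at (g p)) \<circ> F)) (at p)"
      by (rule diff_chain_at[OF F])
    have "continuous (at p) g" using F has_derivative_continuous by blast
    moreover obtain e where "e > 0" "ball (g p) e \<subseteq> W'"
      using h(1,2) gp open_contains_ball by metis
    ultimately obtain d where d: "d > 0" "\<And>q. dist q p < d \<Longrightarrow> g q \<in> W'"
      unfolding continuous_at_eps_delta by (metis dist_commute mem_ball subset_eq)
    have "((\<lambda>q. q) has_derivative (frechet_derivative h (at (g p)) \<circ> F)) (at p)"
    proof (rule has_derivative_transform_within_open[OF comp])
      show "open (ball p d \<inter> W)" "p \<in> ball p d \<inter> W" using g d by auto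
      fix q assume q: "q \<in> ball p d \<inter> W"
      then have "g q \<in> W'" "g q = \<phi> q" "q \<in> A" using d(2)[of q] g by (auto simp: dist_commute)
      then show "(h \<circ> g) q = q" using h(5) ch(4) by (auto simp: homeomorphism_def)
    qed
    then have "frechet_derivative h (at (g p)) \<circ> F = (\<lambda>q. q)"
      using has_derivative_unique has_derivative_ident by blast
    then show ?thesis by (metis inj_on_id2 inj_on_imageI2)
  qed
  have linF: "linear F" using has_derivative_linear[OF F] .
  \<comment> \<open>the tangent space as seen by the chart\<close>
  define T where "T = {v. F v \<in> E}"
  have T: "v \<in> T \<longleftrightarrow> (\<forall>e\<in>orthogonal_comp E. F v \<bullet> e = 0)" for v
  proof -
    have "F v \<in> E \<longleftrightarrow> F v \<in> orthogonal_comp (orthogonal_comp E)"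
      using orthogonal_comp_self[OF ch(7)] by simp
    then show ?thesis by (auto simp: T_def orthogonal_comp_def orthogonal_def inner_commute)
  qed
  have sT: "Real_Vector_Spaces.subspace T"
    unfolding T_def using linear_subspace_vimage[OF linF ch(7)] by (simp add: vimage_def)
  have dimT: "dim T \<le> n"
  proof -
    have "dim T = dim (F ` T)" using dim_image_eq[OF linF, of T] inj by (metis inj_on_subset top_greatest)
    also have "\<dots> \<le> dim E" by (rule dim_subset) (auto simp: T_def)
    finally show ?thesis using ch by simp
  qed
  \<comment> \<open>the function \<open>g \<bullet> e\<close>, turned into a vector field, which \<open>nabla\<close> can differentiate\<close>
  define G where "G = (\<lambda>e q. (g q \<bullet> e) *\<^sub>R e)"
  have L: "bounded_linear (\<lambda>v::'a. (v \<bullet> e) *\<^sub>R e)" for e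
    by (intro bounded_linear_scaleR_const bounded_linear_inner_left)
  have GS: "Ck_on k S (G e)" for k e
    unfolding G_def by (rule Ck_on_bounded_linear[OF S(1) L gS])
  have dG: "frechet_derivative (G e) (at p) v = (F v \<bullet> e) *\<^sub>R e" for e v
    unfolding G_def
    using frechet_derivative_at[OF bounded_linear.has_derivative[OF L F]] by metis
  have G0: "G e q = 0" if "e \<in> orthogonal_comp E" "q \<in> M \<inter> S" for e q
  proof -
    have "g q = \<phi> q" "q \<in> M \<inter> A" using that g by (auto simp: S_def)
    then have "g q \<in> E" using ch(9) by (metis IntD1 imageI)
    then show ?thesis using that by (auto simp: G_def orthogonal_comp_def orthogonal_def)
  qed
  have YT: "Y k p \<in> T" if k: "k \<in> {1..n}" for k
    unfolding T
  proof
    fix e assume e: "e \<in> orthogonal_comp E"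
    have tan: "Y k p \<in> tangent_space M p" using Ytan k p by blast
    have "(F (Y k p) \<bullet> e) *\<^sub>R e = nabla M (Y k) (\<lambda>q. 0) p"
      unfolding dG[symmetric] by (rule nabla_eq_extension[where Z = "Y k", OF GS S(1,2) G0[OF e] tan, symmetric])
    also have "\<dots> = 0" using tan p by (intro nabla_zero) auto
    finally show "F (Y k p) \<bullet> e = 0" by auto
  qed
  have bT: "nabla M (Y i) (Y j) p - nabla M (Y j) (Y i) p \<in> T"
    unfolding T
  proof
    fix e assume e: "e \<in> orthogonal_comp E"
    have "nabla M (Y k) (nabla M (Y l) (\<lambda>q. 0)) p = 0" if "k \<in> {1..n}" "l \<in> {1..n}" for k l
    proof -
      have "nabla M (Y k) (nabla M (Y l) (\<lambda>q. 0)) p = nabla M (Y k) (\<lambda>q. 0) p"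
        by (rule nabla_cong[OF U p]) (use that Ytan in \<open>auto intro!: nabla_zero\<close>)
      then show ?thesis using that Ytan p by (auto intro!: nabla_zero)
    qed
    then have "(F (nabla M (Y i) (Y j) p - nabla M (Y j) (Y i) p) \<bullet> e) *\<^sub>R e = 0"
      using nabla_commutator_extension[OF U S(1,3,2) GS G0[OF e] Ysm[OF ij(1)] _ Ysm[OF ij(2)]] Ytan ij
      by (simp add: dG)
    then show "F (nabla M (Y i) (Y j) p - nabla M (Y j) (Y i) p) \<bullet> e = 0" by auto
  qed
  have "T \<subseteq> span ((\<lambda>k. Y k p) ` {1..n})"
  proof (rule card_ge_dim_independent)
    show "(\<lambda>k. Y k p) ` {1..n} \<subseteq> T" using YT by auto
    show "independent ((\<lambda>k. Y k p) ` {1..n})" using orthonormal_family(2)[of "{1..n}" "\<lambda>k. Y k p"] Yon by auto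
    show "dim T \<le> card ((\<lambda>k. Y k p) ` {1..n})"
      using dimT card_image[OF orthonormal_family(1)[of "{1..n}" "\<lambda>k. Y k p"]] Yon by auto
  qed
  then show ?thesis using bT by blast
qed

lemma nabla_commutator_in_span:
  fixes M U :: "'a::euclidean_space set"
  assumes M: "submanifold n M" and U: "open U" and p: "p \<in> M \<inter> U"
    and Y: "orthonormal_tangent_frame n M U Y" and ij: "i \<in> {1..n}" "j \<in> {1..n}"
    and V: "smooth_on (M \<inter> U) V"
  shows "nabla M (Y i) (nabla M (Y j) V) p - nabla M (Y j) (nabla M (Y i) V) p
    \<in> span ((\<lambda>k. nabla M (Y k) V p) ` {1..n})"
proof -
  have Ysm: "smooth_on (M \<inter> U) (Y k)" and Ytan: "q \<in> M \<inter> U \<Longrightarrow> Y k q \<in> tangent_space M q"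
    if "k \<in> {1..n}" for k q
    using Y that unfolding orthonormal_tangent_frame_def by auto
  obtain W g where g: "open W" "p \<in> W" "W \<subseteq> U" "\<And>k. Ck_on k W g" "\<And>q. q \<in> M \<inter> W \<Longrightarrow> g q = V q"
    using smooth_on_extension[OF V U p] by blast
  have pW: "p \<in> M \<inter> W" using p g by auto
  let ?F = "frechet_derivative g (at p)"
  have lin: "linear ?F" using Ck_on_has_derivative[OF g(4,2)] has_derivative_linear by blast
  have "nabla M (Y i) (nabla M (Y j) V) p - nabla M (Y j) (nabla M (Y i) V) p =
      ?F (nabla M (Y i) (Y j) p - nabla M (Y j) (Y i) p)"
    by (rule nabla_commutator_extension[OF U g(1,3) pW g(4,5) Ysm[OF ij(1)] Ytan[OF ij(1)] Ysm[OF ij(2)] Ytan[OF ij(2)]])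
  also have "\<dots> \<in> ?F ` span ((\<lambda>k. Y k p) ` {1..n})"
    using bracket_in_span_frame[OF M U p Y ij] by (rule imageI)
  also have "\<dots> = span (?F ` (\<lambda>k. Y k p) ` {1..n})" using linear_span_image[OF lin] by metis
  also have "?F ` (\<lambda>k. Y k p) ` {1..n} = (\<lambda>k. nabla M (Y k) V p) ` {1..n}"
    unfolding image_image
    by (rule image_cong[OF refl]) (use nabla_eq_extension[OF g(4,1) pW g(5)] Ytan p in auto)
  finally show ?thesis .
qed

section \<open>Linear algebra\<close>

text \<open>For a Gram matrix \<open>A\<close>, the quadratic form \<open>c \<bullet> A c\<close> is a sum of squares.\<close>

lemma gram_matrix_kernel:
  fixes B :: "'k \<Rightarrow> nat \<Rightarrow> real"
  assumes K: "finite K" and c: "c \<in> carrier_vec m"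
  shows "Matrix.mat m m (\<lambda>(a, b). \<Sum>t\<in>K. B t a * B t b) *\<^sub>v c = 0\<^sub>v m
    \<longleftrightarrow> (\<forall>t\<in>K. (\<Sum>a<m. B t a * vec_index c a) = 0)" (is "?A *\<^sub>v c = _ \<longleftrightarrow> _")
proof -
  define s where "s = (\<lambda>t. \<Sum>a<m. B t a * vec_index c a)"
  have Ac: "vec_index (?A *\<^sub>v c) a = (\<Sum>t\<in>K. B t a * s t)" if "a < m" for a
  proof -
    have "vec_index (?A *\<^sub>v c) a = (\<Sum>b<m. (\<Sum>t\<in>K. B t a * B t b) * vec_index c b)"
      using that c by (simp add: scalar_prod_def atLeast0LessThan)
    also have "\<dots> = (\<Sum>t\<in>K. B t a * s t)"
      by (simp add: s_def sum_distrib_left sum_distrib_right mult.assoc) (rule sum.swap)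
    finally show ?thesis .
  qed
  have "?A *\<^sub>v c = 0\<^sub>v m \<longleftrightarrow> (\<forall>t\<in>K. s t = 0)"
  proof
    assume 0: "?A *\<^sub>v c = 0\<^sub>v m"
    have "(\<Sum>t\<in>K. (s t)\<^sup>2) = (\<Sum>t\<in>K. \<Sum>a<m. vec_index c a * (B t a * s t))"
    proof (rule sum.cong[OF refl])
      fix t
      have "(s t)\<^sup>2 = (\<Sum>a<m. B t a * vec_index c a) * s t" by (simp add: s_def power2_eq_square)
      then show "(s t)\<^sup>2 = (\<Sum>a<m. vec_index c a * (B t a * s t))"
        by (simp add: sum_distrib_left ac_simps)
    qed
    also have "\<dots> = (\<Sum>a<m. vec_index c a * vec_index (?A *\<^sub>v c) a)"
      by (subst sum.swap) (simp add: Ac sum_distrib_left del: index_mult_mat_vec)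
    also have "\<dots> = 0" unfolding 0 by simp
    finally show "\<forall>t\<in>K. s t = 0"
      using sum_nonneg_eq_0_iff[OF K, of "\<lambda>t. (s t)\<^sup>2"] by simp
  next
    assume "\<forall>t\<in>K. s t = 0"
    then show "?A *\<^sub>v c = 0\<^sub>v m" using c by (intro eq_vecI) (simp_all add: Ac del: index_mult_mat_vec)
  qed
  then show ?thesis by (simp only: s_def)
qed

lemma mem_orthogonal_comp_span:
  "w \<in> orthogonal_comp (span S) \<longleftrightarrow> (\<forall>v\<in>S. v \<bullet> w = 0)"
proof
  show "w \<in> orthogonal_comp (span S) \<Longrightarrow> \<forall>v\<in>S. v \<bullet> w = 0"
    by (auto simp: orthogonal_comp_def orthogonal_def span_base)
  assume "\<forall>v\<in>S. v \<bullet> w = 0"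
  moreover have "Real_Vector_Spaces.subspace {v. v \<bullet> w = 0}"
    by (auto simp: Real_Vector_Spaces.subspace_def inner_add_left)
  ultimately show "w \<in> orthogonal_comp (span S)"
    using span_minimal[of S "{v. v \<bullet> w = 0}"] by (auto simp: orthogonal_comp_def orthogonal_def)
qed

lemma mem_span_if_perp:
  fixes S :: "'a::euclidean_space set"
  assumes "\<And>w. w \<in> orthogonal_comp (span S) \<Longrightarrow> v \<bullet> w = 0"
  shows "v \<in> span S"
  using assms orthogonal_comp_self[OF subspace_span, of S]
  by (auto simp: orthogonal_comp_def orthogonal_def inner_commute)

lemma span_span_Un:
  fixes A B :: "'a::real_vector set"
  shows "span (span A \<union> B) = span (A \<union> B)"
  unfolding span_Un[of "span A"] span_Un[of A] span_span ..

lemma span_eqI_orthogonal_comp: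
  fixes S T :: "'a::euclidean_space set"
  assumes "orthogonal_comp (span S) = orthogonal_comp (span T)"
  shows "span S = span T"
  using assms orthogonal_comp_self[OF subspace_span] by metis

lemma orthonormal_expansion:
  fixes f :: "'i \<Rightarrow> 'a::euclidean_space"
  assumes I: "finite I" and on: "\<And>i j. i \<in> I \<Longrightarrow> j \<in> I \<Longrightarrow> f i \<bullet> f j = (if i = j then 1 else 0)"
    and w: "w \<in> span (f ` I)"
  shows "w = (\<Sum>i\<in>I. (w \<bullet> f i) *\<^sub>R f i)"
proof -
  let ?d = "w - (\<Sum>i\<in>I. (w \<bullet> f i) *\<^sub>R f i)"
  have "?d \<in> span (f ` I)"
    using w by (intro span_diff span_sum span_scale) (auto intro: span_base)
  moreover have "f j \<bullet> ?d = 0" if "j \<in> I" for j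
    using on that I by (simp add: inner_diff_right inner_sum_right if_distrib[of "(*) _"] inner_commute cong: if_cong)
  then have "?d \<in> orthogonal_comp (span (f ` I))" by (auto simp: mem_orthogonal_comp_span)
  ultimately have "?d = 0" using orthogonal_Int_0[OF subspace_span] by blast
  then show ?thesis by simp
qed

section \<open>Orthogonal projections\<close>

lemma orth_proj_eqI:
  assumes "Real_Vector_Spaces.subspace W" "w \<in> W" "v - w \<in> orthogonal_comp W"
  shows "orth_proj W v = w"
  unfolding orth_proj_def
proof (rule the_equality)
  fix w' assume w': "w' \<in> W \<and> v - w' \<in> orthogonal_comp W"
  have "(v - w) - (v - w') \<in> orthogonal_comp W"
    using assms(3) w' subspace_diff[OF subspace_orthogonal_comp] by blast
  moreover have "(v - w) - (v - w') \<in> W"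
    using subspace_diff[OF assms(1), of w' w] assms(2) w' by simp
  ultimately have "(v - w) - (v - w') = 0"
    using orthogonal_Int_0[OF assms(1)] by blast
  then show "w' = w" by simp
qed (use assms in auto)

lemma linear_orth_proj:
  assumes W: "Real_Vector_Spaces.subspace W"
  shows "linear (orth_proj W)"
proof -
  have ex: "orth_proj W v \<in> W \<and> v - orth_proj W v \<in> orthogonal_comp W" for v
  proof -
    obtain a b where "v = a + b" "a \<in> W" "b \<in> orthogonal_comp W"
      using subspace_sum_orthogonal_comp[OF W] by (metis UNIV_I set_plus_elim)
    then show ?thesis using orth_proj_eqI[OF W, of a v] by auto
  qed
  show ?thesis
  proof (rule linearI)
    fix v v'
    have "(v - orth_proj W v) + (v' - orth_proj W v') \<in> orthogonal_comp W"
      using ex by (intro subspace_add[OF subspace_orthogonal_comp]) auto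
    then show "orth_proj W (v + v') = orth_proj W v + orth_proj W v'"
      using ex by (intro orth_proj_eqI[OF W] subspace_add[OF W]) (auto simp: algebra_simps)
  next
    fix c v
    have "c *\<^sub>R (v - orth_proj W v) \<in> orthogonal_comp W"
      using ex by (intro subspace_scale[OF subspace_orthogonal_comp]) auto
    then show "orth_proj W (c *\<^sub>R v) = c *\<^sub>R orth_proj W v"
      using ex by (intro orth_proj_eqI[OF W] subspace_scale[OF W]) (auto simp: algebra_simps)
  qed
qed

section \<open>The number of nondecreasing lists\<close>

text \<open>A nonempty nondecreasing list either ends in the largest index \<open>n\<close>, or has all entries below \<open>n\<close>. This is the
  recursion of Pascal's triangle.\<close>

lemma card_sorted_lists_le:
  "finite {js. length js = m \<and> sorted js \<and> set js \<subseteq> {1..n::nat}} \<and>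
   card {js. length js = m \<and> sorted js \<and> set js \<subseteq> {1..n::nat}} \<le> (n + m - 1) choose m"
proof (induction "n + m" arbitrary: n m rule: less_induct)
  case less
  define S where "S = (\<lambda>m n. {js. length js = m \<and> sorted js \<and> set js \<subseteq> {1..n::nat}})"
  consider "m = 0" | m' where "n = 0" "m = Suc m'" | n' m' where "n = Suc n'" "m = Suc m'"
    by (metis not0_implies_Suc)
  then show ?case
  proof cases
    case 1
    then have "{js. length js = m \<and> sorted js \<and> set js \<subseteq> {1..n}} = {[]}" by auto
    then show ?thesis using 1 by simp
  next
    case 2
    then have "{js. length js = m \<and> sorted js \<and> set js \<subseteq> {1..n}} = {}" by auto
    then show ?thesis by (simp only: card.empty finite.emptyI) simp
  next
    case 3
    have IH1: "finite (S m' n)" "card (S m' n) \<le> (n' + m') choose m'"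
      using less.hyps[of n m'] 3 by (auto simp: S_def)
    have IH2: "finite (S m n')" "card (S m n') \<le> (n' + m') choose m"
      using less.hyps[of n' m] 3 by (auto simp: S_def)
    have sub: "S m n \<subseteq> (\<lambda>js. js @ [n]) ` S m' n \<union> S m n'"
    proof
      fix js assume js: "js \<in> S m n"
      then obtain ks a where ka: "js = ks @ [a]" using 3 by (cases js rule: rev_cases) (auto simp: S_def)
      show "js \<in> (\<lambda>js. js @ [n]) ` S m' n \<union> S m n'"
      proof (cases "a = n")
        case True
        then show ?thesis using js ka 3 by (auto simp: S_def sorted_append)
      next
        case False
        then have "a \<le> n'" using js ka 3 by (auto simp: S_def)
        then have "set js \<subseteq> {1..n'}" using js ka by (force simp: S_def sorted_append)
        then show ?thesis using js by (auto simp: S_def)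
      qed
    qed
    have fin: "finite ((\<lambda>js. js @ [n]) ` S m' n \<union> S m n')" using IH1 IH2 by simp
    have "card (S m n) \<le> card ((\<lambda>js. js @ [n]) ` S m' n \<union> S m n')" by (rule card_mono[OF fin sub])
    also have "\<dots> \<le> card ((\<lambda>js. js @ [n]) ` S m' n) + card (S m n')" by (rule card_Un_le)
    also have "\<dots> \<le> ((n' + m') choose m') + ((n' + m') choose m)"
      using IH1 IH2 card_image_le[OF IH1(1), of "\<lambda>js. js @ [n]"] by linarith
    also have "\<dots> = (n + m - 1) choose m" using 3 by simp
    finally show ?thesis using finite_subset[OF sub fin] by (simp add: S_def)
  qed
qed

section \<open>Osculating spaces\<close>

lemma iterated_nabla_singleton: "iterated_nabla M Y [j] = Y j"
  by (simp add: iterated_nabla_def)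

lemma iterated_nabla_Cons:
  "js \<noteq> [] \<Longrightarrow> iterated_nabla M Y (i # js) = nabla M (Y i) (iterated_nabla M Y js)"
  by (simp add: iterated_nabla_def)

lemma finite_nondecreasing_indices: "finite (nondecreasing_indices n s)"
  using card_sorted_lists_le[of "s + 1" n] by (simp add: nondecreasing_indices_def)

lemma card_nondecreasing_indices_le: "card (nondecreasing_indices n s) \<le> (n + s) choose (s + 1)"
  using card_sorted_lists_le[of "s + 1" n] by (simp add: nondecreasing_indices_def)

text \<open>A list of \<open>s + 1\<close> indices stands for a derivative of order \<open>s\<close> of a frame field; \<open>words n l\<close> covers the
  orders up to \<open>l\<close>.\<close>

definition words :: "nat \<Rightarrow> nat \<Rightarrow> nat list set" where
  "words n l = {js. js \<noteq> [] \<and> length js \<le> l + 1 \<and> set js \<subseteq> {1..n}}"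

lemma words_mono: "l \<le> l' \<Longrightarrow> words n l \<subseteq> words n l'"
  by (auto simp: words_def)

lemma Cons_in_words: "j \<in> {1..n} \<Longrightarrow> js \<in> words n l \<Longrightarrow> j # js \<in> words n (Suc l)"
  by (auto simp: words_def)

lemma words_0: "words n 0 = (\<lambda>j. [j]) ` {1..n}"
  by (auto simp: words_def length_Suc_conv le_Suc_eq)

lemma words_Suc: "words n (Suc l) = words n l \<union> (\<lambda>(j, js). j # js) ` ({1..n} \<times> words n l)"
proof
  show "words n (Suc l) \<subseteq> words n l \<union> (\<lambda>(j, js). j # js) ` ({1..n} \<times> words n l)"
  proof
    fix js assume js: "js \<in> words n (Suc l)"
    then obtain a ks where "js = a # ks" by (cases js) (auto simp: words_def)
    then show "js \<in> words n l \<union> (\<lambda>(j, js). j # js) ` ({1..n} \<times> words n l)"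
      using js by (cases "ks = []") (auto simp: words_def)
  qed
qed (use Cons_in_words words_mono[of l "Suc l" n] in auto)

locale normal_vector_construction =
  fixes M U :: "'a::euclidean_space set" and n k r :: nat and Y :: "nat \<Rightarrow> 'a \<Rightarrow> 'a"
    and \<kappa> :: "nat \<Rightarrow> nat" and N \<nu> :: "nat \<Rightarrow> nat \<Rightarrow> 'a \<Rightarrow> 'a"
  assumes M: "submanifold n M" and U: "open U" and Y: "orthonormal_tangent_frame n M U Y"
    and NV: "normal_vectors M U n k r Y \<kappa> N \<nu>"
begin

abbreviation "Osc \<equiv> osculating_space \<kappa> N"
abbreviation "D \<equiv> iterated_nabla M Y"
abbreviation "I l \<equiv> {offset \<kappa> l + 1..k}"

definition derivative_span :: "nat \<Rightarrow> 'a \<Rightarrow> 'a set" where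
  "derivative_span l p = span ((\<lambda>js. D js p) ` words n l)"

text \<open>The derivative along \<open>Y j\<close>, at \<open>p\<close>, of the field with constant coefficients in the frame \<open>\<nu> l\<close> that
  extends the vector \<open>w\<close> orthogonal to \<open>Osc l p\<close>.\<close>

definition frame_derivative :: "nat \<Rightarrow> nat \<Rightarrow> 'a \<Rightarrow> 'a \<Rightarrow> 'a" where
  "frame_derivative l j w p = (\<Sum>\<alpha>\<in>I l. (w \<bullet> \<nu> l \<alpha> p) *\<^sub>R nabla M (Y j) (\<nu> l \<alpha>) p)"

lemma Y_smooth: "j \<in> {1..n} \<Longrightarrow> smooth_on (M \<inter> U) (Y j)"
  and Y_tangent: "j \<in> {1..n} \<Longrightarrow> p \<in> M \<inter> U \<Longrightarrow> Y j p \<in> tangent_space M p"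
  using Y unfolding orthonormal_tangent_frame_def by auto

lemma \<kappa>_0: "\<kappa> 0 = n" and N_0: "i \<in> {1..n} \<Longrightarrow> p \<in> M \<inter> U \<Longrightarrow> N 0 i p = Y i p"
  using NV unfolding normal_vectors_def by auto

lemma \<nu>_smooth: "l < r \<Longrightarrow> \<alpha> \<in> I l \<Longrightarrow> smooth_on (M \<inter> U) (\<nu> l \<alpha>)"
  and \<nu>_orthonormal: "l < r \<Longrightarrow> \<alpha> \<in> I l \<Longrightarrow> \<beta> \<in> I l \<Longrightarrow> p \<in> M \<inter> U \<Longrightarrow>
    \<nu> l \<alpha> p \<bullet> \<nu> l \<beta> p = (if \<alpha> = \<beta> then 1 else 0)"
  and span_\<nu>: "l < r \<Longrightarrow> p \<in> M \<inter> U \<Longrightarrow> span ((\<lambda>\<alpha>. \<nu> l \<alpha> p) ` I l) = orthogonal_comp (Osc l p)"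
  using NV unfolding normal_vectors_def complement_frame_def Let_def by blast+

lemma normal_eigenvectors:
  assumes "l < r" "p \<in> M \<inter> U"
  obtains q where
    "\<kappa> (Suc l) = mat_rank (normal_matrix M n k Y \<kappa> N \<nu> l p)"
    "orthonormal_positive_eigenvectors (normal_matrix M n k Y \<kappa> N \<nu> l p) (\<kappa> (Suc l)) q"
    "\<And>i. i \<in> {1..\<kappa> (Suc l)} \<Longrightarrow> N (Suc l) i p = vector_of_coords k \<kappa> l (\<nu> l) (q i) p"
  using NV assms unfolding normal_vectors_def by (metis Suc_eq_plus1)

lemma osculating_space_0: "p \<in> M \<inter> U \<Longrightarrow> Osc 0 p = span ((\<lambda>j. Y j p) ` {1..n})"
  unfolding osculating_space_def
  by (rule arg_cong[where f = span]) (use \<kappa>_0 N_0 in force)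

lemma osculating_space_Suc:
  "Osc (Suc l) p = span (Osc l p \<union> (\<lambda>i. N (Suc l) i p) ` {1..\<kappa> (Suc l)})"
proof -
  have "{N s i p | s i. s \<le> l \<and> i \<in> {1..\<kappa> s}} = (\<Union>s\<le>l. (\<lambda>i. N s i p) ` {1..\<kappa> s})" for l
    by (simp only: set_eq_iff mem_Collect_eq UN_iff image_iff atMost_iff Bex_def) blast
  then show ?thesis
    unfolding osculating_space_def by (simp add: atMost_Suc Un_commute span_Un span_span)
qed

lemma subspace_osculating_space: "Real_Vector_Spaces.subspace (Osc l p)"
  unfolding osculating_space_def by (rule subspace_span)

lemma N_in_osculating_space: "s \<le> l \<Longrightarrow> i \<in> {1..\<kappa> s} \<Longrightarrow> N s i p \<in> Osc l p"
  unfolding osculating_space_def by (intro span_base) auto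

lemma osculating_space_mono: "l \<le> l' \<Longrightarrow> Osc l p \<subseteq> Osc l' p"
  unfolding osculating_space_def by (rule span_mono) force

lemma perp_osculating_space_Suc:
  "w \<in> orthogonal_comp (Osc (Suc l) p) \<longleftrightarrow>
   w \<in> orthogonal_comp (Osc l p) \<and> (\<forall>i\<in>{1..\<kappa> (Suc l)}. N (Suc l) i p \<bullet> w = 0)"
  unfolding osculating_space_Suc mem_orthogonal_comp_span
  by (auto simp: orthogonal_comp_def orthogonal_def)

lemma iterated_nabla_smooth:
  "js \<noteq> [] \<Longrightarrow> set js \<subseteq> {1..n} \<Longrightarrow> smooth_on (M \<inter> U) (D js)"
proof (induction js)
  case (Cons i js)
  then show ?case
    using Y_smooth Y_tangent
    by (cases "js = []") (auto simp: iterated_nabla_singleton iterated_nabla_Cons intro!: smooth_on_nabla[OF U])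
qed simp

lemma complement_expansion:
  assumes "l < r" "p \<in> M \<inter> U" "w \<in> orthogonal_comp (Osc l p)"
  shows "w = (\<Sum>\<alpha>\<in>I l. (w \<bullet> \<nu> l \<alpha> p) *\<^sub>R \<nu> l \<alpha> p)"
  using orthonormal_expansion[of "I l" "\<lambda>\<alpha>. \<nu> l \<alpha> p" w] \<nu>_orthonormal span_\<nu> assms by auto

text \<open>The derivative of \<open>V\<close> is shifted to the complement frame by differentiating \<open>V \<bullet> \<nu> l \<alpha> = 0\<close>. The
  right-hand side depends on \<open>V\<close> only through its value at \<open>p\<close>.\<close>

lemma inner_nabla_section:
  assumes l: "l < r" and p: "p \<in> M \<inter> U" and j: "j \<in> {1..n}"
    and V: "smooth_on (M \<inter> U) V" "\<And>q. q \<in> M \<inter> U \<Longrightarrow> V q \<in> Osc l q"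
    and w: "w \<in> orthogonal_comp (Osc l p)"
  shows "nabla M (Y j) V p \<bullet> w = - (V p \<bullet> frame_derivative l j w p)"
proof -
  have *: "nabla M (Y j) V p \<bullet> \<nu> l \<alpha> p = - (V p \<bullet> nabla M (Y j) (\<nu> l \<alpha>) p)" if \<alpha>: "\<alpha> \<in> I l" for \<alpha>
  proof (rule inner_nabla_eq_if_orthogonal[where Z = "Y j", OF V(1) \<nu>_smooth[OF l \<alpha>] U p Y_tangent[OF j p]])
    fix q assume q: "q \<in> M \<inter> U"
    have "\<nu> l \<alpha> q \<in> orthogonal_comp (Osc l q)"
      unfolding span_\<nu>[OF l q, symmetric] using \<alpha> by (intro span_base) auto
    then show "V q \<bullet> \<nu> l \<alpha> q = 0"
      using V(2)[OF q] by (auto simp: orthogonal_comp_def orthogonal_def)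
  qed
  have "nabla M (Y j) V p \<bullet> w = (\<Sum>\<alpha>\<in>I l. (w \<bullet> \<nu> l \<alpha> p) * (nabla M (Y j) V p \<bullet> \<nu> l \<alpha> p))"
    by (subst complement_expansion[OF l p w]) (simp add: inner_sum_right)
  also have "\<dots> = - (V p \<bullet> frame_derivative l j w p)"
    by (simp add: * frame_derivative_def inner_sum_right sum_negf)
  finally show ?thesis .
qed

lemma sum_I: "(\<Sum>\<alpha>\<in>I l. f \<alpha>) = (\<Sum>a<k - offset \<kappa> l. f (offset \<kappa> l + 1 + a))"
  by (rule sum.reindex_bij_witness[of _ "\<lambda>a. offset \<kappa> l + 1 + a" "\<lambda>\<alpha>. \<alpha> - (offset \<kappa> l + 1)"]) auto

lemma vector_of_coords_inner:
  "vector_of_coords k \<kappa> l (\<nu> l) c p \<bullet> w =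
     (\<Sum>a<k - offset \<kappa> l. vec_index c a * (w \<bullet> \<nu> l (offset \<kappa> l + 1 + a) p))"
  by (simp add: vector_of_coords_def inner_sum_left) (simp add: inner_commute)

lemma eigenvector_coords:
  assumes "orthonormal_positive_eigenvectors (normal_matrix M n k Y \<kappa> N \<nu> l p) K q" "i \<in> {1..K}"
  shows "q i \<in> carrier_vec (k - offset \<kappa> l)"
  using assms by (auto simp: orthonormal_positive_eigenvectors_def eigenvector_def normal_matrix_def)

text \<open>The coordinates of \<open>w\<close> in the complement frame are in the kernel of the normal matrix if and only if
  the sum of squares given by the quadratic form of that matrix vanishes.\<close>

lemma perp_normal_vectors_iff:
  assumes l: "l < r" and p: "p \<in> M \<inter> U"
  shows "(\<forall>i\<in>{1..\<kappa> (Suc l)}. N (Suc l) i p \<bullet> w = 0) \<longleftrightarrow>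
    (\<forall>i\<in>{1..\<kappa> l}. \<forall>j\<in>{1..n}. N l i p \<bullet> frame_derivative l j w p = 0)"
proof -
  let ?m = "k - offset \<kappa> l" and ?P = "normal_matrix M n k Y \<kappa> N \<nu> l p"
  let ?K = "{1..\<kappa> l} \<times> {1..n}"
  define B where "B = (\<lambda>(i, j) a. N l i p \<bullet> nabla M (Y j) (\<nu> l (offset \<kappa> l + 1 + a)) p)"
  define c where "c = Matrix.vec ?m (\<lambda>a. w \<bullet> \<nu> l (offset \<kappa> l + 1 + a) p)"
  have c: "c \<in> carrier_vec ?m" by (simp add: c_def)
  have P: "?P = Matrix.mat ?m ?m (\<lambda>(a, b). \<Sum>t\<in>?K. B t a * B t b)"
    by (simp add: normal_matrix_def B_def sum.cartesian_product case_prod_unfold)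
  obtain q where q: "\<kappa> (Suc l) = mat_rank ?P" "orthonormal_positive_eigenvectors ?P (\<kappa> (Suc l)) q"
    "\<And>i. i \<in> {1..\<kappa> (Suc l)} \<Longrightarrow> N (Suc l) i p = vector_of_coords k \<kappa> l (\<nu> l) (q i) p"
    using normal_eigenvectors[OF l p] by blast
  have "N (Suc l) i p \<bullet> w = scalar_prod c (q i)" if i: "i \<in> {1..\<kappa> (Suc l)}" for i
    using eigenvector_coords[OF q(2) i]
    by (simp add: q(3)[OF i] vector_of_coords_inner scalar_prod_def c_def atLeast0LessThan mult.commute)
  then have "(\<forall>i\<in>{1..\<kappa> (Suc l)}. N (Suc l) i p \<bullet> w = 0) \<longleftrightarrow> (\<forall>i\<in>{1..mat_rank ?P}. scalar_prod c (q i) = 0)"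
    using q(1) by auto
  also have "\<dots> \<longleftrightarrow> ?P *\<^sub>v c = 0\<^sub>v ?m"
  proof (rule orthogonal_to_positive_eigenvectors_iff_in_kernel[OF _ _ _ c])
    show "?P \<in> carrier_mat ?m ?m" by (simp add: P)
    show "transpose_mat ?P = ?P" unfolding P by (intro eq_matI) (simp_all add: mult.commute)
    show "orthonormal_positive_eigenvectors ?P (mat_rank ?P) q" using q(1,2) by simp
  qed
  also have "\<dots> \<longleftrightarrow> (\<forall>t\<in>?K. (\<Sum>a<?m. B t a * vec_index c a) = 0)"
    unfolding P by (rule gram_matrix_kernel[OF _ c]) simp
  also have "\<dots> \<longleftrightarrow> (\<forall>i\<in>{1..\<kappa> l}. \<forall>j\<in>{1..n}. N l i p \<bullet> frame_derivative l j w p = 0)"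
    unfolding frame_derivative_def sum_I inner_sum_right by (simp add: B_def c_def mult.commute)
  finally show ?thesis .
qed

lemma N_orthonormal_complement:
  assumes l: "l < r" and p: "p \<in> M \<inter> U" and i: "i \<in> {1..\<kappa> (Suc l)}"
  shows "N (Suc l) i p \<in> orthogonal_comp (Osc l p)"
    and "j \<in> {1..\<kappa> (Suc l)} \<Longrightarrow> N (Suc l) i p \<bullet> N (Suc l) j p = (if i = j then 1 else 0)"
proof -
  let ?m = "k - offset \<kappa> l" and ?P = "normal_matrix M n k Y \<kappa> N \<nu> l p"
  obtain q where q: "orthonormal_positive_eigenvectors ?P (\<kappa> (Suc l)) q"
    "\<And>i. i \<in> {1..\<kappa> (Suc l)} \<Longrightarrow> N (Suc l) i p = vector_of_coords k \<kappa> l (\<nu> l) (q i) p"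
    using normal_eigenvectors[OF l p] by blast
  have in_I: "offset \<kappa> l + 1 + a \<in> I l" if "a < ?m" for a using that by auto
  show "N (Suc l) i p \<in> orthogonal_comp (Osc l p)"
    unfolding q(2)[OF i] vector_of_coords_def span_\<nu>[OF l p, symmetric]
    by (intro span_sum span_scale span_base imageI in_I) simp
  assume j: "j \<in> {1..\<kappa> (Suc l)}"
  have *: "N (Suc l) j p \<bullet> \<nu> l (offset \<kappa> l + 1 + a) p = vec_index (q j) a" if a: "a < ?m" for a
  proof -
    have "N (Suc l) j p \<bullet> \<nu> l (offset \<kappa> l + 1 + a) p =
        (\<Sum>b<?m. vec_index (q j) b * (\<nu> l (offset \<kappa> l + 1 + a) p \<bullet> \<nu> l (offset \<kappa> l + 1 + b) p))"
      unfolding q(2)[OF j] by (rule vector_of_coords_inner)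
    also have "\<dots> = (\<Sum>b<?m. if b = a then vec_index (q j) a else 0)"
      by (rule sum.cong[OF refl], subst \<nu>_orthonormal[OF l in_I in_I p]) (use a in auto)
    finally show ?thesis using a by simp
  qed
  have "N (Suc l) i p \<bullet> N (Suc l) j p = (\<Sum>a<?m. vec_index (q i) a * vec_index (q j) a)"
    by (subst q(2)[OF i], unfold vector_of_coords_inner) (rule sum.cong[OF refl], subst *, auto)
  also have "\<dots> = scalar_prod (q i) (q j)"
    using eigenvector_coords[OF q(1) j] by (simp add: scalar_prod_def atLeast0LessThan)
  finally have "N (Suc l) i p \<bullet> N (Suc l) j p = scalar_prod (q i) (q j)" .
  then show "N (Suc l) i p \<bullet> N (Suc l) j p = (if i = j then 1 else 0)"
    using q(1) i j by (simp add: orthonormal_positive_eigenvectors_def)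
qed

section \<open>Osculating spaces and iterated derivatives\<close>

lemma derivative_span_mono: "l \<le> l' \<Longrightarrow> derivative_span l p \<subseteq> derivative_span l' p"
  unfolding derivative_span_def by (intro span_mono image_mono words_mono)

lemma iterated_nabla_in_derivative_span: "js \<in> words n l \<Longrightarrow> D js p \<in> derivative_span l p"
  unfolding derivative_span_def by (intro span_base imageI)

lemma perp_derivative_span_Suc:
  "w \<in> orthogonal_comp (derivative_span (Suc l) p) \<longleftrightarrow> w \<in> orthogonal_comp (derivative_span l p) \<and>
    (\<forall>j\<in>{1..n}. \<forall>js\<in>words n l. nabla M (Y j) (D js) p \<bullet> w = 0)"
proof -
  have "D (j # js) = nabla M (Y j) (D js)" if "js \<in> words n l" for j js
    using that by (intro iterated_nabla_Cons) (auto simp: words_def)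
  then show ?thesis
    unfolding derivative_span_def mem_orthogonal_comp_span words_Suc image_Un ball_Un by auto
qed

lemma inner_nabla_iterated_nabla:
  assumes l: "l < r" and p: "p \<in> M \<inter> U" and j: "j \<in> {1..n}" and js: "js \<in> words n l"
    and eq: "\<And>q. q \<in> M \<inter> U \<Longrightarrow> Osc l q = derivative_span l q"
    and w: "w \<in> orthogonal_comp (Osc l p)"
  shows "nabla M (Y j) (D js) p \<bullet> w = - (D js p \<bullet> frame_derivative l j w p)"
proof (rule inner_nabla_section[OF l p j _ _ w])
  show "smooth_on (M \<inter> U) (D js)" using js by (intro iterated_nabla_smooth) (auto simp: words_def)
  show "D js q \<in> Osc l q" if "q \<in> M \<inter> U" for q
    using eq[OF that] iterated_nabla_in_derivative_span[OF js] by simp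
qed

text \<open>Only the \<open>l\<close>-th normal vectors enter the normal matrix. Those of lower order are orthogonal
  to \<open>frame_derivative l j w p\<close> automatically: the derivative of an iterated derivative of order below \<open>l\<close> stays in \<open>Osc l p\<close> and so is
  orthogonal to \<open>w\<close>, and this derivative computes the inner product with \<open>frame_derivative\<close>.\<close>

lemma perp_osculating_space_Suc_iff:
  assumes l: "l < r" and p: "p \<in> M \<inter> U"
    and eq: "\<And>s q. s \<le> l \<Longrightarrow> q \<in> M \<inter> U \<Longrightarrow> Osc s q = derivative_span s q"
    and w: "w \<in> orthogonal_comp (Osc l p)"
  shows "w \<in> orthogonal_comp (Osc (Suc l) p) \<longleftrightarrow>
    (\<forall>j\<in>{1..n}. \<forall>v\<in>Osc l p. v \<bullet> frame_derivative l j w p = 0)"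
proof -
  note word_inner = inner_nabla_iterated_nabla[OF l p _ _ eq[OF order_refl] w]
  have lower: "v \<bullet> frame_derivative l j w p = 0"
    if j: "j \<in> {1..n}" and s: "s < l" and v: "v \<in> Osc s p" for j s v
  proof -
    have "D js p \<bullet> frame_derivative l j w p = 0" if js: "js \<in> words n s" for js
    proof -
      have "D (j # js) p \<in> Osc l p"
        using iterated_nabla_in_derivative_span[OF Cons_in_words[OF j js]] derivative_span_mono[of "Suc s" l p] s
          eq[OF order_refl p] by auto
      then have "nabla M (Y j) (D js) p \<bullet> w = 0"
        using w js by (auto simp: words_def iterated_nabla_Cons orthogonal_comp_def orthogonal_def)
      then show ?thesis using word_inner[OF j, of js] js words_mono[of s l n] s by auto
    qed
    then have "frame_derivative l j w p \<in> orthogonal_comp (derivative_span s p)"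
      unfolding derivative_span_def by (auto simp: mem_orthogonal_comp_span)
    then show ?thesis using v eq[of s p] s p by (auto simp: orthogonal_comp_def orthogonal_def)
  qed
  have "w \<in> orthogonal_comp (Osc (Suc l) p) \<longleftrightarrow>
      (\<forall>j\<in>{1..n}. \<forall>i\<in>{1..\<kappa> l}. N l i p \<bullet> frame_derivative l j w p = 0)"
    using w perp_osculating_space_Suc perp_normal_vectors_iff[OF l p] by blast
  also have "\<dots> \<longleftrightarrow> (\<forall>j\<in>{1..n}. frame_derivative l j w p \<in> orthogonal_comp (Osc l p))"
  proof (intro ball_cong refl)
    fix j assume j: "j \<in> {1..n}"
    show "(\<forall>i\<in>{1..\<kappa> l}. N l i p \<bullet> frame_derivative l j w p = 0) \<longleftrightarrow>
        frame_derivative l j w p \<in> orthogonal_comp (Osc l p)" (is "?A \<longleftrightarrow> ?B")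
    proof
      assume ?A
      then have "N s i p \<bullet> frame_derivative l j w p = 0" if "s \<le> l" "i \<in> {1..\<kappa> s}" for s i
        using lower[OF j, of s] N_in_osculating_space[OF order_refl that(2)] that by (cases "s = l") auto
      then show ?B unfolding osculating_space_def mem_orthogonal_comp_span by auto
    next
      assume ?B
      then show ?A using N_in_osculating_space[of l l] by (auto simp: orthogonal_comp_def orthogonal_def)
    qed
  qed
  finally show ?thesis by (simp add: orthogonal_comp_def orthogonal_def)
qed

text \<open>Equality at all points of \<open>M \<inter> U\<close> and at all lower levels is needed in the induction step, because
  the iterated derivatives are differentiated as sections of the osculating spaces.\<close>

lemma osculating_space_eq_derivative_span:
  "l \<le> r \<Longrightarrow> p \<in> M \<inter> U \<Longrightarrow> Osc l p = derivative_span l p"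
proof (induction l arbitrary: p rule: less_induct)
  case (less l)
  show ?case
  proof (cases l)
    case 0
    then show ?thesis
      using less.prems by (simp add: osculating_space_0 derivative_span_def words_0 image_image iterated_nabla_singleton)
  next
    case (Suc m)
    then have m: "m < r" using less.prems by simp
    have eq: "Osc s q = derivative_span s q" if "s \<le> m" "q \<in> M \<inter> U" for s q
      using less.IH[of s q] less.prems that Suc by simp
    have "orthogonal_comp (Osc (Suc m) p) = orthogonal_comp (derivative_span (Suc m) p)"
    proof (rule Set.set_eqI)
      fix w
      show "w \<in> orthogonal_comp (Osc (Suc m) p) \<longleftrightarrow> w \<in> orthogonal_comp (derivative_span (Suc m) p)"
      proof (cases "w \<in> orthogonal_comp (Osc m p)")
        case False
        then show ?thesis
          using perp_osculating_space_Suc perp_derivative_span_Suc eq[OF order_refl less.prems(2)] by simp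
      next
        case True
        note D = inner_nabla_iterated_nabla[OF m less.prems(2) _ _ eq[OF order_refl] True]
        have "w \<in> orthogonal_comp (Osc (Suc m) p) \<longleftrightarrow>
            (\<forall>j\<in>{1..n}. frame_derivative m j w p \<in> orthogonal_comp (derivative_span m p))"
          using perp_osculating_space_Suc_iff[OF m less.prems(2) eq True] eq[OF order_refl less.prems(2)]
          by (simp add: orthogonal_comp_def orthogonal_def)
        also have "\<dots> \<longleftrightarrow> (\<forall>j\<in>{1..n}. \<forall>js\<in>words n m. nabla M (Y j) (D js) p \<bullet> w = 0)"
          unfolding derivative_span_def mem_orthogonal_comp_span using D by simp
        also have "\<dots> \<longleftrightarrow> w \<in> orthogonal_comp (derivative_span (Suc m) p)"
          using True perp_derivative_span_Suc eq[OF order_refl less.prems(2)] by simp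
        finally show ?thesis .
      qed
    qed
    then show ?thesis
      unfolding Suc osculating_space_def derivative_span_def by (rule span_eqI_orthogonal_comp)
  qed
qed

text \<open>By duality there is no need to write \<open>V\<close> as a combination of iterated derivatives with smooth
  coefficients.\<close>

lemma nabla_in_osculating_space_Suc:
  assumes l: "l < r" and p: "p \<in> M \<inter> U" and j: "j \<in> {1..n}"
    and V: "smooth_on (M \<inter> U) V" "\<And>q. q \<in> M \<inter> U \<Longrightarrow> V q \<in> Osc l q"
  shows "nabla M (Y j) V p \<in> Osc (Suc l) p"
proof -
  have eq: "Osc s q = derivative_span s q" if "s \<le> l" "q \<in> M \<inter> U" for s q
    using osculating_space_eq_derivative_span[of s q] that l by simp
  show ?thesis
    unfolding osculating_space_def
  proof (rule mem_span_if_perp, fold osculating_space_def)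
    fix w assume w: "w \<in> orthogonal_comp (Osc (Suc l) p)"
    then have w': "w \<in> orthogonal_comp (Osc l p)" by (simp add: perp_osculating_space_Suc)
    have "V p \<bullet> frame_derivative l j w p = 0"
      using perp_osculating_space_Suc_iff[OF l p eq w'] w j V(2)[OF p] by blast
    then show "nabla M (Y j) V p \<bullet> w = 0"
      using inner_nabla_section[OF l p j V w'] by simp
  qed
qed

section \<open>Reordering the derivatives\<close>

text \<open>For empty \<open>us\<close> the two fields differ by a commutator, of lower order. Their difference is thus a field with
  values in an osculating space, and remains one under the outer derivatives along \<open>us\<close>, each of which
  raises the order by one.\<close>

lemma iterated_nabla_swap:
  assumes "set (us @ i # j # vs) \<subseteq> {1..n}" and "length us + length vs < r" and "p \<in> M \<inter> U"
  shows "D (us @ i # j # vs) p - D (us @ j # i # vs) p \<in> Osc (length us + length vs) p"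
  using assms
proof (induction us arbitrary: p)
  case Nil
  then have ij: "i \<in> {1..n}" "j \<in> {1..n}" and p: "p \<in> M \<inter> U" and vs: "set vs \<subseteq> {1..n}" by auto
  show ?case
  proof (cases "vs = []")
    case True
    then show ?thesis
      using bracket_in_span_frame[OF M U p Y ij] osculating_space_0[OF p]
      by (simp add: iterated_nabla_Cons iterated_nabla_singleton)
  next
    case False
    have "(\<lambda>k. nabla M (Y k) (D vs) p) ` {1..n} \<subseteq> Osc (length vs) p"
    proof (intro image_subsetI)
      fix k assume "k \<in> {1..n}"
      then have "D (k # vs) p \<in> derivative_span (length vs) p"
        using vs by (intro iterated_nabla_in_derivative_span) (auto simp: words_def)
      then show "nabla M (Y k) (D vs) p \<in> Osc (length vs) p"
        using osculating_space_eq_derivative_span[of "length vs" p] Nil p False by (simp add: iterated_nabla_Cons)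
    qed
    then have "span ((\<lambda>k. nabla M (Y k) (D vs) p) ` {1..n}) \<subseteq> Osc (length vs) p"
      by (rule span_minimal[OF _ subspace_osculating_space])
    then show ?thesis
      using nabla_commutator_in_span[OF M U p Y ij iterated_nabla_smooth[OF False vs]] False
      by (auto simp: iterated_nabla_Cons)
  qed
next
  case (Cons u us)
  let ?a = "us @ i # j # vs" and ?b = "us @ j # i # vs"
  have u: "u \<in> {1..n}" and p: "p \<in> M \<inter> U" using Cons.prems by auto
  have sm: "smooth_on (M \<inter> U) (D ?a)" "smooth_on (M \<inter> U) (D ?b)"
    using Cons.prems by (intro iterated_nabla_smooth; auto)+
  have "D (u # ?a) p - D (u # ?b) p = nabla M (Y u) (\<lambda>q. D ?a q - D ?b q) p"
    using nabla_diff[where Z = "Y u", OF sm U p Y_tangent[OF u p]] by (simp add: iterated_nabla_Cons)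
  also have "\<dots> \<in> Osc (Suc (length us + length vs)) p"
    using Cons by (intro nabla_in_osculating_space_Suc p u smooth_on_diff sm) auto
  finally show ?case by simp
qed

lemma iterated_nabla_insort:
  assumes "set (us @ a # xs) \<subseteq> {1..n}" and "length us + length xs \<le> r" and "p \<in> M \<inter> U"
  shows "D (us @ a # xs) p - D (us @ insort a xs) p \<in> Osc (length us + length xs - 1) p"
  using assms(1,2)
proof (induction xs arbitrary: us)
  case Nil
  then show ?case using subspace_0[OF subspace_osculating_space] by simp
next
  case (Cons b xs)
  show ?case
  proof (cases "a \<le> b")
    case True
    then show ?thesis using subspace_0[OF subspace_osculating_space] by simp
  next
    case False
    have "D (us @ a # b # xs) p - D (us @ b # a # xs) p \<in> Osc (length us + length xs) p"
      using Cons.prems assms(3) by (intro iterated_nabla_swap) auto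
    moreover have "D ((us @ [b]) @ a # xs) p - D ((us @ [b]) @ insort a xs) p \<in> Osc (length us + length xs) p"
      using Cons.IH[of "us @ [b]"] Cons.prems by simp
    ultimately show ?thesis
      using False subspace_add[OF subspace_osculating_space, of "D (us @ a # b # xs) p - D (us @ b # a # xs) p"]
      by fastforce
  qed
qed

text \<open>Insertion sort moves every index by adjacent swaps. The prefix \<open>us\<close> is there for the induction on \<open>xs\<close>.\<close>

lemma iterated_nabla_sort:
  assumes "set (us @ xs) \<subseteq> {1..n}" and "length us + length xs \<le> Suc r" and "p \<in> M \<inter> U"
  shows "D (us @ xs) p - D (us @ sort xs) p \<in> Osc (length us + length xs - 2) p"
  using assms(1,2)
proof (induction xs arbitrary: us)
  case Nil
  then show ?case using subspace_0[OF subspace_osculating_space] by simp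
next
  case (Cons a xs)
  have "D ((us @ [a]) @ xs) p - D ((us @ [a]) @ sort xs) p \<in> Osc (length us + length xs - 1) p"
    using Cons.IH[of "us @ [a]"] Cons.prems by simp
  moreover have "D (us @ a # sort xs) p - D (us @ insort a (sort xs)) p \<in> Osc (length us + length (sort xs) - 1) p"
    using Cons.prems assms(3) by (intro iterated_nabla_insort) auto
  ultimately show ?case
    using subspace_add[OF subspace_osculating_space, of "D ((us @ [a]) @ xs) p - D ((us @ [a]) @ sort xs) p"]
    by fastforce
qed

lemma osculating_space_Suc_nondecreasing:
  assumes l: "l < r" and p: "p \<in> M \<inter> U"
  shows "Osc (Suc l) p = span (Osc l p \<union> (\<lambda>js. D js p) ` nondecreasing_indices n (Suc l))" (is "_ = ?R")
proof
  have eq: "Osc (Suc l) p = derivative_span (Suc l) p" using osculating_space_eq_derivative_span[of "Suc l"] l p by simp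
  have nw: "nondecreasing_indices n (Suc l) \<subseteq> words n (Suc l)"
    by (auto simp: nondecreasing_indices_def words_def)
  show "?R \<subseteq> Osc (Suc l) p"
    using osculating_space_mono[of l "Suc l" p] iterated_nabla_in_derivative_span nw eq
    by (intro span_minimal subspace_osculating_space) auto
  have "D js p \<in> ?R" if js: "js \<in> words n (Suc l)" for js
  proof (cases "length js \<le> l + 1")
    case True
    then have "D js p \<in> Osc l p"
      using js osculating_space_eq_derivative_span[of l p] l p iterated_nabla_in_derivative_span[of js l p]
      by (simp add: words_def)
    then show ?thesis by (intro span_base) simp
  next
    case False
    then have len: "length js = l + 2" using js by (simp add: words_def)
    then have sorted: "sort js \<in> nondecreasing_indices n (Suc l)"
      using js by (simp add: nondecreasing_indices_def words_def)
    have "D js p - D (sort js) p \<in> Osc l p"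
      using iterated_nabla_sort[of "[]" js p] js len l p by (simp add: words_def)
    then have "(D js p - D (sort js) p) + D (sort js) p \<in> ?R"
      using sorted by (intro span_add) (auto intro: span_base)
    then show ?thesis by simp
  qed
  then show "Osc (Suc l) p \<subseteq> ?R"
    unfolding eq derivative_span_def by (intro span_minimal subspace_span) auto
qed

lemma osculating_space_eq_span_nondecreasing:
  assumes "l \<le> r" and p: "p \<in> M \<inter> U"
  shows "Osc l p = span ({Y i p | i. i \<in> {1..n}} \<union>
    {D js p | s js. s \<in> {1..l} \<and> js \<in> nondecreasing_indices n s})"
proof -
  have union: "{D js p | s js. s \<in> {1..l} \<and> js \<in> nondecreasing_indices n s} =
      (\<Union>s\<in>{1..l}. (\<lambda>js. D js p) ` nondecreasing_indices n s)" for l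
    by (simp only: set_eq_iff mem_Collect_eq UN_iff image_iff Bex_def) blast
  have "Osc l p = span ((\<lambda>i. Y i p) ` {1..n} \<union>
      (\<Union>s\<in>{1..l}. (\<lambda>js. D js p) ` nondecreasing_indices n s))" (is "_ = span (?G l)")
    using assms(1)
  proof (induction l)
    case 0
    then show ?case using osculating_space_0[OF p] by simp
  next
    case (Suc l)
    have "Osc (Suc l) p = span (span (?G l) \<union> (\<lambda>js. D js p) ` nondecreasing_indices n (Suc l))"
      using osculating_space_Suc_nondecreasing[of l p] Suc p by simp
    also have "\<dots> = span (?G l \<union> (\<lambda>js. D js p) ` nondecreasing_indices n (Suc l))"
      by (rule span_span_Un)
    also have "?G l \<union> (\<lambda>js. D js p) ` nondecreasing_indices n (Suc l) = ?G (Suc l)"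
      by (simp add: atLeastAtMostSuc_conv Un_ac)
    finally show ?case .
  qed
  then show ?thesis unfolding union Setcompr_eq_image .
qed

section \<open>The span of the normal vectors of highest order\<close>

text \<open>The projection kills \<open>Osc l p\<close> and fixes the new normal vectors. Applied to the two sets of generators
  of \<open>Osc (Suc l) p\<close> over \<open>Osc l p\<close>, it yields the two sides.\<close>

lemma span_normal_vectors_eq_span_orth_proj:
  assumes l: "l < r" and p: "p \<in> M \<inter> U"
  shows "span ((\<lambda>i. N (Suc l) i p) ` {1..\<kappa> (Suc l)}) =
    span ((\<lambda>js. orth_proj (orthogonal_comp (Osc l p)) (D js p)) ` nondecreasing_indices n (Suc l))"
proof -
  let ?A = "orthogonal_comp (Osc l p)"
  have A: "Real_Vector_Spaces.subspace ?A" by (rule subspace_orthogonal_comp)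
  have proj_0: "orth_proj ?A v = 0" if "v \<in> Osc l p" for v
    using orth_proj_eqI[OF A subspace_0[OF A], of v] orthogonal_comp_subset[of "Osc l p"] that by auto
  have proj_id: "orth_proj ?A v = v" if "v \<in> ?A" for v
    using orth_proj_eqI[OF A that, of v] subspace_0[OF subspace_orthogonal_comp[of ?A]] by simp
  have image_span: "orth_proj ?A ` span (Osc l p \<union> S) = span (orth_proj ?A ` S)" for S
  proof -
    have "orth_proj ?A ` span (Osc l p \<union> S) = span (orth_proj ?A ` Osc l p \<union> orth_proj ?A ` S)"
      using linear_span_image[OF linear_orth_proj[OF A]] by (metis image_Un)
    also have "orth_proj ?A ` Osc l p = {0}"
      using proj_0 subspace_0[OF subspace_osculating_space] by (auto simp: image_iff)
    finally show ?thesis using span_insert_0 by simp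
  qed
  have "orth_proj ?A ` Osc (Suc l) p = span (orth_proj ?A ` (\<lambda>i. N (Suc l) i p) ` {1..\<kappa> (Suc l)})"
    unfolding osculating_space_Suc by (rule image_span)
  also have "orth_proj ?A ` (\<lambda>i. N (Suc l) i p) ` {1..\<kappa> (Suc l)} = (\<lambda>i. N (Suc l) i p) ` {1..\<kappa> (Suc l)}"
    unfolding image_image by (intro image_cong refl proj_id N_orthonormal_complement[OF l p])
  finally have 1: "orth_proj ?A ` Osc (Suc l) p = span ((\<lambda>i. N (Suc l) i p) ` {1..\<kappa> (Suc l)})" .
  have "orth_proj ?A ` Osc (Suc l) p =
      span (orth_proj ?A ` (\<lambda>js. D js p) ` nondecreasing_indices n (Suc l))"
    unfolding osculating_space_Suc_nondecreasing[OF l p] by (rule image_span)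
  then show ?thesis using 1 by (simp add: image_image)
qed

lemma rank_le_binomial:
  assumes l: "l < r" and p: "p \<in> M \<inter> U"
  shows "\<kappa> (Suc l) \<le> (n + Suc l) choose (Suc l + 1)"
proof -
  let ?P = "\<lambda>js. orth_proj (orthogonal_comp (Osc l p)) (D js p)"
  let ?J = "nondecreasing_indices n (Suc l)"
  have "\<kappa> (Suc l) = dim (span ((\<lambda>i. N (Suc l) i p) ` {1..\<kappa> (Suc l)}))"
    using orthonormal_family(3)[of "{1..\<kappa> (Suc l)}" "\<lambda>i. N (Suc l) i p"] N_orthonormal_complement(2)[OF l p]
    by simp
  also have "\<dots> = dim (?P ` ?J)" unfolding span_normal_vectors_eq_span_orth_proj[OF l p] by (rule dim_span)
  also have "\<dots> \<le> card (?P ` ?J)" using finite_nondecreasing_indices by (intro dim_le_card') simp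
  also have "\<dots> \<le> card ?J" by (rule card_image_le[OF finite_nondecreasing_indices])
  also have "\<dots> \<le> (n + Suc l) choose (Suc l + 1)" by (rule card_nondecreasing_indices_le)
  finally show ?thesis .
qed

end

theorem mainTheorem1:
  fixes M U :: "(real ^ 'm) set"
    and x :: "real ^ 'm"
    and n k r :: nat
    and Y :: "nat \<Rightarrow> real ^ 'm \<Rightarrow> real ^ 'm"
    and \<kappa> :: "nat \<Rightarrow> nat"
    and N \<nu> :: "nat \<Rightarrow> nat \<Rightarrow> real ^ 'm \<Rightarrow> real ^ 'm"
  assumes "CARD('m) = n + k"
    and "submanifold n M"
    and "x \<in> M"
    and "r \<ge> 1"
    and "open U" and "x \<in> U"
    and "orthonormal_tangent_frame n M U Y"
    and "normal_vectors M U n k r Y \<kappa> N \<nu>"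
  shows "(\<kappa> r = mat_rank (normal_matrix M n k Y \<kappa> N \<nu> (r - 1) x) \<and> \<kappa> r \<le> (n + r) choose (r + 1)) \<and>
    span {N r i x | i. i \<in> {1..\<kappa> r}} =
      span {orth_proj (orthogonal_comp (osculating_space \<kappa> N (r - 1) x)) (iterated_nabla M Y js x)
            | js. js \<in> nondecreasing_indices n r} \<and>
    osculating_space \<kappa> N r x =
      span ({Y i x | i. i \<in> {1..n}} \<union>
            {iterated_nabla M Y js x | s js. s \<in> {1..r} \<and> js \<in> nondecreasing_indices n s})"
proof -
  interpret normal_vector_construction M U n k r Y \<kappa> N \<nu>
    using assms by unfold_locales
  have x: "x \<in> M \<inter> U" using assms by simp
  obtain l where r: "r = Suc l" using assms(4) by (cases r) auto
  have l: "l < r" by (simp add: r)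
  have "\<kappa> r = mat_rank (normal_matrix M n k Y \<kappa> N \<nu> (r - 1) x)"
    using normal_eigenvectors[OF l x] by (metis diff_Suc_1 r)
  moreover have "\<kappa> r \<le> (n + r) choose (r + 1)"
    using rank_le_binomial[OF l x] by (simp add: r)
  moreover have "span {N r i x | i. i \<in> {1..\<kappa> r}} =
      span {orth_proj (orthogonal_comp (osculating_space \<kappa> N (r - 1) x)) (iterated_nabla M Y js x)
            | js. js \<in> nondecreasing_indices n r}"
    using span_normal_vectors_eq_span_orth_proj[OF l x] unfolding r Setcompr_eq_image by simp
  ultimately show ?thesis
    using osculating_space_eq_span_nondecreasing[OF order_refl x] by blast
qed

end
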